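(* Let $X_1,\ldots,X_n$ be i.i.d. with density $s$ on $[0,1]$ and let $\{S_m\}_{m\in\mathcal M_n}$ be a collection of models satisfying (Pol) and (P-NP). Let $\bar m=\mathrm{argmin}_{m\in\mathcal M_n}\mathbb E[\|s-\widehat s_m\|^2]$ be such that (BeMo) holds true, and assume (SqI), (RegD), (Dmax) and (LoEx) (all assumptions are stated in the context). For every $1\le p\le n-1$ let $\widehat m=\widehat m(p)=\mathrm{argmin}_{m\in\mathcal M_n}\widehat R_p(m)$, where $\widehat R_p(m)$ is the leave-$p$-out risk estimator of $\widehat s_m$. If $s\in\bigcup_{m\in\mathcal M_n}S_m$, then for every sequence $1\le p=p_n\le n-1$ such that $$\log(n)\Big(1-\frac pn\Big)\xrightarrow[n\to+\infty]{}0\qquad\text{and}\qquad n\Big(1-\frac pn\Big)\xrightarrow[n\to+\infty]{}+\infty,$$ one has $$\mathbb P[\widehat m=\bar m]\xrightarrow[n\to+\infty]{}1 .$$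
   Context: $\|\cdot\|$ is the norm of $L^2([0,1])$. For each $n$, $\mathcal M_n$ is a (countable) index set; for $m\in\mathcal M_n$, $\{\varphi_\lambda\}_{\lambda\in\Lambda(m)}$ is a finite orthonormal family of real-valued measurable functions in $L^2([0,1])$, $S_m$ its linear span, $D_m=\dim S_m$, $s_m$ the orthogonal projection of $s$ onto $S_m$, and $\phi_m=\sum_{\lambda\in\Lambda(m)}\varphi_\lambda^2$. The projection estimator is $\widehat s_m=\sum_{\lambda\in\Lambda(m)}\big(\frac1n\sum_{i=1}^n\varphi_\lambda(X_i)\big)\varphi_\lambda$. Leave-$p$-out: for $e\subset\{1,\ldots,n\}$ with $\mathrm{Card}(e)=p$, $\widehat s_m(X^{(e)})=\sum_{\lambda\in\Lambda(m)}\big(\frac1{n-p}\sum_{i\notin e}\varphi_\lambda(X_i)\big)\varphi_\lambda$, and with $\gamma(u;x)=\|u\|^2-2u(x)$, $\mathcal E_p=\{e:\mathrm{Card}(e)=p\}$, $\widehat R_p(m)=\binom np^{-1}\sum_{e\in\mathcal E_p}\frac1p\sum_{i\in e}\gamma(\widehat s_m(X^{(e)});X_i)$. Assumptions (constants do not depend on $n$): (SqI) $s\in L^2([0,1])$. (Pol) There is $a_{\mathcal M}\ge0$ with $\mathrm{Card}(\mathcal M_n)\le n^{a_{\mathcal M}}$. (RegD) There is $\Phi>0$ with $\sup_{m\in\mathcal M_n}\|\phi_m\|_\infty/D_m\le\Phi$. (Dmax) $\sup_{m\in\mathcal M_n}D_m\le\Gamma\, n/(\log n)^2$, with $\Gamma=1$.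 (LoEx) There is $\xi>0$ with $\inf_{m\in\mathcal M_n}\sqrt n\,\mathbb E(\|s_m-\widehat s_m\|)/\sqrt{D_m}\ge\sqrt\xi$. (BeMo) There exist $\mu>0$ and $n_0\in\mathbb N^*$ such that for every integer $n>n_0$, $(1+\mu)\,\mathbb E[\|s-\widehat s_{\bar m}\|^2]\le\inf_{m\in\mathcal M_n\setminus\{\bar m\}}\mathbb E[\|s-\widehat s_m\|^2]$. (P-NP) $\mathcal M_n=\mathcal M_{n,P}\cup\mathcal M_{n,NP}$, where for parametric models ($m\in\mathcal M_{n,P}$) there are constants $\pi,\tau>0$ independent of $n$ with $\sup_{m\in\mathcal M_{n,P}}\{n\mathbb E[\|s_m-\widehat s_m\|^2]\}\le\pi$ and $\inf_{m\in\mathcal M_{n,P},\,s\notin S_m}\{\|s-s_m\|^2\}\ge\tau$, and for nonparametric models ($m\in\mathcal M_{n,NP}$) $n(\log n)^{-2}\inf_{m\in\mathcal M_{n,NP}}\mathbb E[\|s_m-\widehat s_m\|^2]\to+\infty$ as $n\to+\infty$. The index $\bar m$ is deterministic and may depend on $n$.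
   Formalization: The condition that s lies in the union of the S_m over M_n is read as: for all large n, s lies in S_m for some parametric m in M_{n,P} (automatic for a fixed true model); if s lies only in nonparametric models of growing dimension the claim can fail. *)

theory Defs
  imports "HOL-Probability.Probability" "HOL-Library.Function_Algebras"
begin

abbreviation unit_lborel :: "real measure" where
  "unit_lborel \<equiv> restrict_space lborel {0..1}"

text \<open>Square-integrable classes are represented by functions; only the values on the unit interval
  matter, and two functions that agree almost everywhere represent the same element.\<close>

definition L2 :: "(real \<Rightarrow> real) set" where
  "L2 = {f \<in> borel_measurable unit_lborel. integrable unit_lborel (\<lambda>x. (f x)\<^sup>2)}"

definition L2_inner :: "(real \<Rightarrow> real) \<Rightarrow> (real \<Rightarrow> real) \<Rightarrow> real" where
  "L2_inner f g = (LINT x|unit_lborel. f x * g x)"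

definition L2_norm :: "(real \<Rightarrow> real) \<Rightarrow> real" where
  "L2_norm f = sqrt (LINT x|unit_lborel. (f x)\<^sup>2)"

definition Linf_norm :: "(real \<Rightarrow> real) \<Rightarrow> ereal" where
  "Linf_norm f = esssup unit_lborel (\<lambda>x. ereal \<bar>f x\<bar>)"

definition fun_scale :: "real \<Rightarrow> (real \<Rightarrow> real) \<Rightarrow> (real \<Rightarrow> real)" where
  "fun_scale c f = (\<lambda>x. c * f x)"

lemma vector_space_fun_scale: "vector_space fun_scale"
  by unfold_locales (auto simp: fun_scale_def fun_eq_iff algebra_simps)

text \<open>Membership up to equality almost everywhere, for a set \<open>S\<close> of representatives.\<close>

definition L2_mem :: "(real \<Rightarrow> real) \<Rightarrow> (real \<Rightarrow> real) set \<Rightarrow> bool" where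
  "L2_mem f S \<longleftrightarrow> (\<exists>t\<in>S. AE x in unit_lborel. f x = t x)"

text \<open>The orthogonality relation determines \<open>t\<close> almost everywhere when \<open>S\<close> is a linear subspace;
  for a \<open>model_span\<close> of an orthonormal family such a \<open>t\<close> exists and is unique.\<close>

definition L2_proj :: "(real \<Rightarrow> real) set \<Rightarrow> (real \<Rightarrow> real) \<Rightarrow> (real \<Rightarrow> real)" where
  "L2_proj S f = (SOME t. t \<in> S \<and> (\<forall>u\<in>S. L2_inner (\<lambda>x. f x - t x) u = 0))"

definition orthonormal_family :: "('l \<Rightarrow> real \<Rightarrow> real) \<Rightarrow> 'l set \<Rightarrow> bool" where
  "orthonormal_family \<phi> L \<longleftrightarrow>
     (\<forall>l\<in>L. \<phi> l \<in> L2) \<and>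
     (\<forall>l\<in>L. \<forall>k\<in>L. L2_inner (\<phi> l) (\<phi> k) = (if l = k then 1 else 0))"

text \<open>Span and dimension are taken among functions. As members of an orthonormal family remain
  linearly independent modulo null functions, the dimension is that of the space of classes.\<close>

definition model_span :: "('l \<Rightarrow> real \<Rightarrow> real) \<Rightarrow> 'l set \<Rightarrow> (real \<Rightarrow> real) set" where
  "model_span \<phi> L = module.span fun_scale (\<phi> ` L)"

definition model_dim :: "('l \<Rightarrow> real \<Rightarrow> real) \<Rightarrow> 'l set \<Rightarrow> nat" where
  "model_dim \<phi> L = vector_space.dim fun_scale (model_span \<phi> L)"

definition model_proj :: "('l \<Rightarrow> real \<Rightarrow> real) \<Rightarrow> 'l set \<Rightarrow> (real \<Rightarrow> real) \<Rightarrow> (real \<Rightarrow> real)" where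
  "model_proj \<phi> L s = L2_proj (model_span \<phi> L) s"

definition model_phi :: "('l \<Rightarrow> real \<Rightarrow> real) \<Rightarrow> 'l set \<Rightarrow> (real \<Rightarrow> real)" where
  "model_phi \<phi> L = (\<lambda>y. \<Sum>l\<in>L. (\<phi> l y)\<^sup>2)"

text \<open>The projection estimator computed from the observations \<open>x i\<close> with \<open>i \<in> J\<close>:
  \<open>J = {1..n}\<close> gives the estimator on the full sample, \<open>J = {1..n} - e\<close> the one on the
  sample deprived of the observations with index in \<open>e\<close>.\<close>

definition proj_estimator ::
  "('l \<Rightarrow> real \<Rightarrow> real) \<Rightarrow> 'l set \<Rightarrow> nat set \<Rightarrow> (nat \<Rightarrow> real) \<Rightarrow> (real \<Rightarrow> real)" where
  "proj_estimator \<phi> L J x =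
     (\<lambda>y. \<Sum>l\<in>L. (1 / real (card J) * (\<Sum>i\<in>J. \<phi> l (x i))) * \<phi> l y)"

definition contrast :: "(real \<Rightarrow> real) \<Rightarrow> real \<Rightarrow> real" where
  "contrast u x = (L2_norm u)\<^sup>2 - 2 * u x"

definition lpo_risk ::
  "('l \<Rightarrow> real \<Rightarrow> real) \<Rightarrow> 'l set \<Rightarrow> nat \<Rightarrow> nat \<Rightarrow> (nat \<Rightarrow> real) \<Rightarrow> real" where
  "lpo_risk \<phi> L n p x =
     1 / real (n choose p) *
       (\<Sum>e | e \<subseteq> {1..n} \<and> card e = p.
          1 / real p * (\<Sum>i\<in>e. contrast (proj_estimator \<phi> L ({1..n} - e) x) (x i)))"

definition quad_risk ::
  "'w measure \<Rightarrow> (nat \<Rightarrow> 'w \<Rightarrow> real) \<Rightarrow> nat \<Rightarrow> (real \<Rightarrow> real) \<Rightarrow>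
   ('l \<Rightarrow> real \<Rightarrow> real) \<Rightarrow> 'l set \<Rightarrow> real" where
  "quad_risk P X n s \<phi> L =
     (LINT w|P. (L2_norm (\<lambda>y. s y - proj_estimator \<phi> L {1..n} (\<lambda>i. X i w) y))\<^sup>2)"

definition est_error2 ::
  "'w measure \<Rightarrow> (nat \<Rightarrow> 'w \<Rightarrow> real) \<Rightarrow> nat \<Rightarrow> (real \<Rightarrow> real) \<Rightarrow>
   ('l \<Rightarrow> real \<Rightarrow> real) \<Rightarrow> 'l set \<Rightarrow> real" where
  "est_error2 P X n s \<phi> L =
     (LINT w|P. (L2_norm (\<lambda>y. model_proj \<phi> L s y
                               - proj_estimator \<phi> L {1..n} (\<lambda>i. X i w) y))\<^sup>2)"

definition est_error1 ::
  "'w measure \<Rightarrow> (nat \<Rightarrow> 'w \<Rightarrow> real) \<Rightarrow> nat \<Rightarrow> (real \<Rightarrow> real) \<Rightarrow>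
   ('l \<Rightarrow> real \<Rightarrow> real) \<Rightarrow> 'l set \<Rightarrow> real" where
  "est_error1 P X n s \<phi> L =
     (LINT w|P. L2_norm (\<lambda>y. model_proj \<phi> L s y
                              - proj_estimator \<phi> L {1..n} (\<lambda>i. X i w) y))"

definition bias2 :: "(real \<Rightarrow> real) \<Rightarrow> ('l \<Rightarrow> real \<Rightarrow> real) \<Rightarrow> 'l set \<Rightarrow> real" where
  "bias2 s \<phi> L = (L2_norm (\<lambda>y. s y - model_proj \<phi> L s y))\<^sup>2"

end

theory Submission
  imports Defs
begin

text \<open>Fix a sample size \<open>n\<close> and put \<open>k = n - p\<close>. For a model \<open>m\<close> of dimension \<open>D\<close> let \<open>b\<close> be its squared bias
and \<open>V\<close> the sum of the variances of \<open>\<phi>\<^sub>\<lambda>(X)\<close>, so that the quadratic risk is \<open>b + V / n\<close>. Averaging over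
the held-out sets gives a closed form of the leave-p-out risk as a U-statistic (\<open>lpo_risk_centered\<close>).
Its expectation is \<open>b + V / k - \<parallel>s\<parallel>\<^sup>2\<close>: it is an unbiased estimator of the risk for a training sample of
size \<open>k\<close>, up to a constant. Two facts about this expectation and its fluctuations give the theorem.

The gap. As \<open>s\<close> lies in a parametric model, the risk of the oracle is \<open>O(1/n)\<close>. Hence the oracle is
parametric, contains \<open>s\<close>, and its \<open>V\<close> is bounded. A competitor that contains \<open>s\<close> and is parametric has
\<open>V\<close> larger by a factor \<open>1 + \<mu>\<close>; a nonparametric one has \<open>V\<close> tending to infinity; a parametric one that
misses \<open>s\<close> has a bias at least \<open>\<tau>\<close>, which beats the variance term \<open>V / k\<close> of the oracle because \<open>k\<close> tends
to infinity. In all three cases the expectation exceeds that of the oracle by at least \<open>b / 2 + c D / k\<close>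
(\<open>oracle_gap\<close>).

The fluctuations. Let \<open>\<chi>\<close> be the distance between the projection of \<open>s\<close> and its estimator. The degenerate
part of the U-statistic is at most \<open>2 \<chi>\<^sup>2\<close>; the linear part differs from that of the oracle by a centered
empirical mean whose summands have a variance of order \<open>b\<close>; and the remaining term is the centered
empirical mean of \<open>\<phi>\<^sub>m\<close>, divided by \<open>k\<close>. Each is a small fraction of \<open>b / 2 + c D / k\<close> except with probability \<open>O(exp(- \<gamma> n / k))\<close>: the first by a
dimension-free subgaussian inequality for sums of independent vectors (\<open>prob_L2_set_sum_ge\<close>, used in
\<open>prob_chi_ge\<close>), the second by an exponential inequality of Bernstein type (\<open>prob_linear_part_ge\<close>), and
the last by the first inequality in dimension one (\<open>prob_mean_phi_ge\<close>). The condition on \<open>log(n) k / n\<close>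
says exactly that \<open>n / k\<close> is much larger than \<open>log n\<close>, so these probabilities remain negligible after
summation over the polynomially many models.\<close>

section \<open>Concentration of sums of independent vectors\<close>

lemma power_convex_combination:
  fixes a b \<theta> :: real
  assumes "0 \<le> a" "0 \<le> b" "0 \<le> \<theta>" "\<theta> \<le> 1"
  shows "(\<theta> * a + (1 - \<theta>) * b) ^ k \<le> \<theta> * a ^ k + (1 - \<theta>) * b ^ k"
proof -
  have "convex_on {0::real..} (\<lambda>x. x ^ k)"
    using convex_power_odd[of k] convex_power_even[of k] convex_on_subset[of UNIV _ "{0::real..}"]
    by (cases "even k") auto
  from convex_onD[OF this, of "1 - \<theta>" a b] assms show ?thesis by simp
qed

text \<open>The function \<open>u \<mapsto> cosh \<surd>u\<close> is a power series with nonnegative coefficients, hence convex on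
\<open>u \<ge> 0\<close>.\<close>

lemma cosh_sqrt_convex_combination:
  fixes a b \<theta> :: real
  assumes "0 \<le> \<theta>" "\<theta> \<le> 1"
  shows "cosh (sqrt (\<theta> * a\<^sup>2 + (1 - \<theta>) * b\<^sup>2)) \<le> \<theta> * cosh a + (1 - \<theta>) * cosh b"
proof (rule sums_le)
  show "(\<lambda>n. if even n then sqrt (\<theta> * a\<^sup>2 + (1 - \<theta>) * b\<^sup>2) ^ n /\<^sub>R fact n else 0)
          sums cosh (sqrt (\<theta> * a\<^sup>2 + (1 - \<theta>) * b\<^sup>2))"
    by (rule cosh_converges)
  show "(\<lambda>n. \<theta> * (if even n then a ^ n /\<^sub>R fact n else 0)
           + (1 - \<theta>) * (if even n then b ^ n /\<^sub>R fact n else 0))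
          sums (\<theta> * cosh a + (1 - \<theta>) * cosh b)"
    by (intro sums_add sums_mult cosh_converges)
  fix n
  show "(if even n then sqrt (\<theta> * a\<^sup>2 + (1 - \<theta>) * b\<^sup>2) ^ n /\<^sub>R fact n else 0)
     \<le> \<theta> * (if even n then a ^ n /\<^sub>R fact n else 0)
           + (1 - \<theta>) * (if even n then b ^ n /\<^sub>R fact n else 0)"
  proof (cases "even n")
    case True
    then obtain k where n: "n = 2 * k" by (auto elim: evenE)
    have "sqrt (\<theta> * a\<^sup>2 + (1 - \<theta>) * b\<^sup>2) ^ n = (\<theta> * a\<^sup>2 + (1 - \<theta>) * b\<^sup>2) ^ k"
      using assms by (simp add: n power_mult)
    also have "\<dots> \<le> \<theta> * (a\<^sup>2) ^ k + (1 - \<theta>) * (b\<^sup>2) ^ k"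
      using assms by (intro power_convex_combination) auto
    also have "\<dots> = \<theta> * a ^ n + (1 - \<theta>) * b ^ n"
      by (simp add: n power_mult)
    finally have "sqrt (\<theta> * a\<^sup>2 + (1 - \<theta>) * b\<^sup>2) ^ n * inverse (fact n)
        \<le> (\<theta> * a ^ n + (1 - \<theta>) * b ^ n) * inverse (fact n)"
      by (rule mult_right_mono) simp
    with True show ?thesis by (simp add: algebra_simps)
  qed simp
qed

text \<open>Think of \<open>r\<close> and \<open>c\<close> as the lengths of two vectors with inner product \<open>z\<close>. The squared length of their
sum lies between \<open>(r - c)\<^sup>2\<close> and \<open>(r + c)\<^sup>2\<close>, and the convex function \<open>cosh \<surd>u\<close> stays below its chord
on this interval. The bound is affine in \<open>z\<close>, so the second term vanishes on averaging over a centered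
vector that is independent of the first.\<close>

lemma cosh_norm_add_le:
  fixes r c z :: real
  assumes "0 \<le> r" "0 \<le> c" "\<bar>z\<bar> \<le> r * c"
  shows "cosh (sqrt (r\<^sup>2 + 2 * z + c\<^sup>2)) \<le> cosh r * cosh c + sinh r / r * (sinh c / c) * z"
proof (cases "r = 0 \<or> c = 0")
  case True
  then show ?thesis using assms by auto
next
  case False
  with assms have rc: "r > 0" "c > 0" "r * c > 0" by auto
  \<comment> \<open>the position of \<open>r\<^sup>2 + 2 z + c\<^sup>2\<close> between \<open>(r - c)\<^sup>2\<close> and \<open>(r + c)\<^sup>2\<close>\<close>
  define \<theta> where "\<theta> = (r * c + z) / (2 * (r * c))"
  have \<theta>: "0 \<le> \<theta>" "\<theta> \<le> 1"
    using abs_le_D1[OF assms(3)] abs_le_D2[OF assms(3)] rc by (simp_all add: \<theta>_def divide_simps mult.commute)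
  have z: "z = (2 * \<theta> - 1) * (r * c)"
    using rc by (simp add: \<theta>_def field_simps)
  have "r\<^sup>2 + 2 * z + c\<^sup>2 = \<theta> * (r + c)\<^sup>2 + (1 - \<theta>) * (r - c)\<^sup>2"
    unfolding z by (simp add: algebra_simps power2_eq_square)
  then have "cosh (sqrt (r\<^sup>2 + 2 * z + c\<^sup>2)) \<le> \<theta> * cosh (r + c) + (1 - \<theta>) * cosh (r - c)"
    using cosh_sqrt_convex_combination[OF \<theta>] by simp
  also have "\<dots> = cosh r * cosh c + (2 * \<theta> - 1) * (sinh r * sinh c)"
    by (simp add: cosh_add cosh_diff algebra_simps)
  also have "(2 * \<theta> - 1) * (sinh r * sinh c) = sinh r / r * (sinh c / c) * z"
    unfolding z using rc by (simp add: field_simps)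
  finally show ?thesis .
qed

lemma two_power_fact_le: "2 ^ k * fact k \<le> (fact (2 * k) :: real)"
proof (induction k)
  case (Suc k)
  have "2 ^ Suc k * fact (Suc k) = (2 * real (Suc k)) * (2 ^ k * fact k :: real)"
    by simp
  also have "\<dots> \<le> (2 * real (Suc k)) * fact (2 * k)"
    using Suc by (intro mult_left_mono) auto
  also have "\<dots> \<le> (2 * real (Suc k)) * (real (2 * k + 1) * fact (2 * k))"
    by (intro mult_left_mono) auto
  also have "\<dots> = fact (2 * Suc k)" by (simp add: algebra_simps)
  finally show ?case .
qed simp

text \<open>Coefficientwise comparison: \<open>x\<^sup>2\<^sup>k / (2k)!\<close> against \<open>x\<^sup>2\<^sup>k / (2\<^sup>k k!)\<close>.\<close>

lemma cosh_le_exp_half_square: "cosh x \<le> exp (x\<^sup>2 / 2)" for x :: real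
proof -
  have "(\<lambda>k. (if even (2 * k) then x ^ (2 * k) /\<^sub>R fact (2 * k) else 0)) sums cosh x"
    by (subst sums_mono_reindex[of "(*) 2" "\<lambda>n. if even n then x ^ n /\<^sub>R fact n else 0"])
       (auto simp: strict_mono_def image_iff elim!: evenE intro: cosh_converges)
  then have 1: "(\<lambda>k. x ^ (2 * k) /\<^sub>R fact (2 * k)) sums cosh x" by simp
  have 2: "(\<lambda>k. (x\<^sup>2 / 2) ^ k /\<^sub>R fact k) sums exp (x\<^sup>2 / 2)" by (rule exp_converges)
  show ?thesis
  proof (rule sums_le[OF _ 1 2])
    fix k
    have "(x\<^sup>2) ^ k / fact (2 * k) \<le> (x\<^sup>2) ^ k / (2 ^ k * fact k)"
      using two_power_fact_le[of k] by (intro divide_left_mono) auto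
    also have "\<dots> = (x\<^sup>2 / 2) ^ k / fact k" by (simp add: power_divide)
    finally show "x ^ (2 * k) /\<^sub>R fact (2 * k) \<le> (x\<^sup>2 / 2) ^ k /\<^sub>R fact k"
      by (simp only: power_mult real_scaleR_def divide_inverse_commute)
  qed
qed


lemma measurable_L2_set [measurable]:
  assumes "finite L" "\<And>l. l \<in> L \<Longrightarrow> f l \<in> borel_measurable M"
  shows "(\<lambda>x. L2_set (\<lambda>l. f l x) L) \<in> borel_measurable M"
  unfolding L2_set_def using assms by measurable

lemma L2_set_sum_le: "L2_set (\<lambda>l. \<Sum>i\<in>I. f i l) L \<le> (\<Sum>i\<in>I. L2_set (f i) L)"
proof (induction I rule: infinite_finite_induct)
  case (insert i I)
  then show ?case
    using L2_set_triangle_ineq[of "f i" "\<lambda>l. \<Sum>i\<in>I. f i l" L] by simp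
qed (simp_all add: L2_set_def)

lemma cosh_L2_set_add_le:
  assumes "finite L" "L2_set y L \<le> c"
  shows "cosh (L2_set (\<lambda>l. x l + y l) L)
    \<le> cosh (L2_set x L) * cosh c
       + (\<Sum>l\<in>L. sinh c / c * (sinh (L2_set x L) / L2_set x L * x l * y l))"
proof -
  let ?r = "L2_set x L" and ?z = "\<Sum>l\<in>L. x l * y l"
  have c: "0 \<le> c" using assms(2) L2_set_nonneg[of y L] by linarith
  have "\<bar>?z\<bar> \<le> (\<Sum>l\<in>L. \<bar>x l\<bar> * \<bar>y l\<bar>)"
    by (rule order_trans[OF sum_abs]) (simp add: abs_mult)
  also have "\<dots> \<le> ?r * L2_set y L" by (rule L2_set_mult_ineq)
  also have "\<dots> \<le> ?r * c" using assms(2) by (intro mult_left_mono) auto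
  finally have z: "\<bar>?z\<bar> \<le> ?r * c" .
  have sq: "(L2_set f L)\<^sup>2 = (\<Sum>l\<in>L. (f l)\<^sup>2)" for f :: "'a \<Rightarrow> real"
    by (simp add: L2_set_def sum_nonneg)
  have "(L2_set (\<lambda>l. x l + y l) L)\<^sup>2 = ?r\<^sup>2 + 2 * ?z + (L2_set y L)\<^sup>2"
    by (simp add: sq power2_sum sum.distrib sum_distrib_left mult.assoc)
  also have "\<dots> \<le> ?r\<^sup>2 + 2 * ?z + c\<^sup>2"
    using assms(2) by (intro add_left_mono power_mono) auto
  finally have "L2_set (\<lambda>l. x l + y l) L \<le> sqrt (?r\<^sup>2 + 2 * ?z + c\<^sup>2)"
    by (rule real_le_rsqrt)
  then have "cosh (L2_set (\<lambda>l. x l + y l) L) \<le> cosh (sqrt (?r\<^sup>2 + 2 * ?z + c\<^sup>2))"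
    using order_trans[OF L2_set_nonneg] by (subst cosh_real_nonneg_le_iff) blast+
  also have "\<dots> \<le> cosh ?r * cosh c + sinh ?r / ?r * (sinh c / c) * ?z"
    by (rule cosh_norm_add_le) (use z c in auto)
  also have "sinh ?r / ?r * (sinh c / c) * ?z
      = (\<Sum>l\<in>L. sinh c / c * (sinh ?r / ?r * x l * y l))"
    by (simp add: sum_distrib_left sum_divide_distrib ac_simps)
  finally show ?thesis .
qed

text \<open>Independence of the past of a vector-valued random walk from one coordinate of its next increment.\<close>

lemma (in prob_space) indep_var_sums:
  fixes Y :: "'l \<Rightarrow> 'b \<Rightarrow> real"
  assumes "finite L" "indep_vars (\<lambda>_. N) X (insert i I)" "finite I" "i \<notin> I"
    "\<And>l. l \<in> L \<Longrightarrow> Y l \<in> borel_measurable N" "h \<in> borel_measurable (PiM L (\<lambda>_. borel))"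
    "k \<in> L"
  shows "indep_var borel (\<lambda>w. h (\<lambda>l\<in>L. \<Sum>j\<in>I. Y l (X j w))) borel (\<lambda>w. Y k (X i w))"
proof -
  have "indep_var
    borel ((\<lambda>f. h (\<lambda>l\<in>L. \<Sum>j\<in>I. Y l (f j))) \<circ> (\<lambda>w. restrict (\<lambda>j. X j w) I))
    borel ((\<lambda>f. Y k (f i)) \<circ> (\<lambda>w. restrict (\<lambda>j. X j w) {i}))"
  proof (intro indep_var_compose[OF indep_var_restrict[OF assms(2)]])
    have [measurable]: "\<And>l. l \<in> L \<Longrightarrow> Y l \<in> borel_measurable N" by fact
    have [measurable]: "h \<in> borel_measurable (PiM L (\<lambda>_. borel))" by fact
    show "(\<lambda>f. h (\<lambda>l\<in>L. \<Sum>j\<in>I. Y l (f j))) \<in> borel_measurable (Pi\<^sub>M I (\<lambda>_. N))"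
      by measurable
    show "(\<lambda>f. Y k (f i)) \<in> borel_measurable (Pi\<^sub>M {i} (\<lambda>_. N))"
      using assms(7) by measurable
  qed (use assms in auto)
  also have "(\<lambda>f. h (\<lambda>l\<in>L. \<Sum>j\<in>I. Y l (f j))) \<circ> (\<lambda>w. restrict (\<lambda>j. X j w) I)
      = (\<lambda>w. h (\<lambda>l\<in>L. \<Sum>j\<in>I. Y l (X j w)))"
    by (auto simp: fun_eq_iff intro!: arg_cong[where f=h] sum.cong)
  also have "(\<lambda>f. Y k (f i)) \<circ> (\<lambda>w. restrict (\<lambda>j. X j w) {i}) = (\<lambda>w. Y k (X i w))"
    by auto
  finally show ?thesis .
qed

text \<open>One increment multiplies the expectation by at most \<open>cosh c\<close>, because the affine term of
\<open>cosh_L2_set_add_le\<close> has expectation zero. The dimension of the vectors does not enter.\<close>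

lemma (in prob_space) expectation_cosh_L2_set_sum_le:
  fixes Y :: "'l \<Rightarrow> 'b \<Rightarrow> real"
  assumes "finite L" "finite I" "indep_vars (\<lambda>_. N) X I"
    and Y: "\<And>l. l \<in> L \<Longrightarrow> Y l \<in> borel_measurable N"
    and "\<And>i. i \<in> I \<Longrightarrow> AE w in M. L2_set (\<lambda>l. Y l (X i w)) L \<le> c"
    and "\<And>i l. i \<in> I \<Longrightarrow> l \<in> L \<Longrightarrow> expectation (\<lambda>w. Y l (X i w)) = 0"
  shows "integrable M (\<lambda>w. cosh (L2_set (\<lambda>l. \<Sum>i\<in>I. Y l (X i w)) L))
    \<and> expectation (\<lambda>w. cosh (L2_set (\<lambda>l. \<Sum>i\<in>I. Y l (X i w)) L)) \<le> cosh c ^ card I"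
  using assms(2,3,5,6)
proof (induction I rule: finite_induct)
  case empty
  then show ?case by (simp add: prob_space L2_set_def)
next
  case (insert i I)
  let ?S = "\<lambda>l w. \<Sum>j\<in>I. Y l (X j w)"
  let ?r = "\<lambda>w. L2_set (\<lambda>l. ?S l w) L"
  have X[measurable]: "X j \<in> measurable M N" if "j \<in> insert i I" for j
    using insert.prems(1) that by (auto simp: indep_vars_def)
  have YX[measurable]: "(\<lambda>w. Y l (X j w)) \<in> borel_measurable M" if "j \<in> insert i I" "l \<in> L" for j l
    using measurable_compose[OF X Y] that by auto
  have S[measurable]: "?S l \<in> borel_measurable M" if "l \<in> L" for l
    using that by (intro borel_measurable_sum YX) auto
  have r[measurable]: "?r \<in> borel_measurable M"
    using assms(1) S by measurable
  have IH: "integrable M (\<lambda>w. cosh (?r w))" "expectation (\<lambda>w. cosh (?r w)) \<le> cosh c ^ card I"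
    using insert.IH[OF indep_vars_subset[OF insert.prems(1)]] insert.prems by auto
  have bnd: "AE w in M. \<forall>j\<in>insert i I. L2_set (\<lambda>l. Y l (X j w)) L \<le> c"
    using insert.prems(2) insert.hyps by (subst AE_finite_all) auto
  have rle: "AE w in M. ?r w \<le> card I * c"
    using bnd
  proof eventually_elim
    case (elim w)
    have "?r w \<le> (\<Sum>j\<in>I. L2_set (\<lambda>l. Y l (X j w)) L)" by (rule L2_set_sum_le)
    also have "\<dots> \<le> (\<Sum>j\<in>I. c)" using elim by (intro sum_mono) auto
    finally show ?case by simp
  qed
  let ?q = "\<lambda>l w. sinh (?r w) / ?r w * ?S l w"
  have q_meas: "?q l \<in> borel_measurable M" if "l \<in> L" for l
    using that unfolding sinh_def by measurable
  have q: "integrable M (?q l)" if l: "l \<in> L" for l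
  proof (rule integrable_const_bound[where B = "sinh (card I * c)"])
    show "AE w in M. norm (?q l w) \<le> sinh (card I * c)"
      using rle
    proof eventually_elim
      case (elim w)
      have "\<bar>?S l w\<bar> \<le> L2_set (\<lambda>l. \<bar>?S l w\<bar>) L"
        by (rule member_le_L2_set[of L l "\<lambda>l. \<bar>?S l w\<bar>"]) (use assms(1) l in auto)
      then have 1: "\<bar>?S l w\<bar> \<le> ?r w" by (simp add: L2_set_def)
      have "\<bar>?q l w\<bar> = sinh (?r w) / ?r w * \<bar>?S l w\<bar>"
        by (simp add: abs_mult)
      also have "\<dots> \<le> sinh (?r w) / ?r w * ?r w"
        using 1 by (intro mult_left_mono) auto
      also have "\<dots> \<le> sinh (?r w)" by simp
      also have "\<dots> \<le> sinh (card I * c)" using elim by simp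
      finally show ?case by simp
    qed
  qed (rule q_meas[OF l])
  have YX_int: "integrable M (\<lambda>w. Y l (X i w))" if l: "l \<in> L" for l
  proof (rule integrable_const_bound[where B = c])
    show "AE w in M. norm (Y l (X i w)) \<le> c"
      using bnd
    proof eventually_elim
      case (elim w)
      have "\<bar>Y l (X i w)\<bar> \<le> L2_set (\<lambda>l. \<bar>Y l (X i w)\<bar>) L"
        by (rule member_le_L2_set[of L l "\<lambda>l. \<bar>Y l (X i w)\<bar>"]) (use assms(1) l in auto)
      with elim show ?case by (simp add: L2_set_def)
    qed
  qed (use YX l in auto)
  have ind: "indep_var borel (?q l) borel (\<lambda>w. Y l (X i w))" if l: "l \<in> L" for l
  proof -
    let ?h = "\<lambda>x. sinh (L2_set x L) / L2_set x L * x l"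
    have "?h \<in> borel_measurable (PiM L (\<lambda>_. borel))"
      using l assms(1) unfolding sinh_def L2_set_def by measurable
    from indep_var_sums[OF assms(1) insert.prems(1) insert.hyps Y this l]
    show ?thesis using l by (simp cong: L2_set_cong)
  qed
  have cross: "integrable M (\<lambda>w. ?q l w * Y l (X i w))" "expectation (\<lambda>w. ?q l w * Y l (X i w)) = 0"
    if l: "l \<in> L" for l
    using indep_var_integrable[OF ind q YX_int] indep_var_lebesgue_integral[OF ind q YX_int]
      insert.prems(3)[of i l] l by auto
  have scaled: "integrable M (\<lambda>w. sinh c / c * (?q l w * Y l (X i w)))" if "l \<in> L" for l
    by (rule integrable_mult_right) (rule cross(1)[OF that])
  let ?R = "\<lambda>w. cosh (?r w) * cosh c + (\<Sum>l\<in>L. sinh c / c * (?q l w * Y l (X i w)))"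
  have R: "integrable M ?R"
    by (intro Bochner_Integration.integrable_add integrable_mult_left Bochner_Integration.integrable_sum
        scaled IH)
  have le: "AE w in M. cosh (L2_set (\<lambda>l. \<Sum>j\<in>insert i I. Y l (X j w)) L) \<le> ?R w"
    using bnd
  proof eventually_elim
    case (elim w)
    have "(\<lambda>l. \<Sum>j\<in>insert i I. Y l (X j w)) = (\<lambda>l. ?S l w + Y l (X i w))"
      using insert.hyps by (simp add: add.commute)
    with cosh_L2_set_add_le[OF assms(1), of "\<lambda>l. Y l (X i w)" c "\<lambda>l. ?S l w"] elim show ?case
      by simp
  qed
  have L: "integrable M (\<lambda>w. cosh (L2_set (\<lambda>l. \<Sum>j\<in>insert i I. Y l (X j w)) L))"
  proof (rule Bochner_Integration.integrable_bound[OF R])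
    show "(\<lambda>w. cosh (L2_set (\<lambda>l. \<Sum>j\<in>insert i I. Y l (X j w)) L)) \<in> borel_measurable M"
      using assms(1) YX unfolding cosh_def by measurable
    show "AE w in M. norm (cosh (L2_set (\<lambda>l. \<Sum>j\<in>insert i I. Y l (X j w)) L)) \<le> norm (?R w)"
      using le by eventually_elim auto
  qed
  have "expectation (\<lambda>w. cosh (L2_set (\<lambda>l. \<Sum>j\<in>insert i I. Y l (X j w)) L)) \<le> expectation ?R"
    by (rule integral_mono_AE[OF L R le])
  also have "expectation ?R = expectation (\<lambda>w. cosh (?r w) * cosh c)
      + expectation (\<lambda>w. \<Sum>l\<in>L. sinh c / c * (?q l w * Y l (X i w)))"
    by (intro Bochner_Integration.integral_add integrable_mult_left Bochner_Integration.integrable_sum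
        scaled IH)
  also have "expectation (\<lambda>w. \<Sum>l\<in>L. sinh c / c * (?q l w * Y l (X i w)))
      = (\<Sum>l\<in>L. sinh c / c * expectation (\<lambda>w. ?q l w * Y l (X i w)))"
    by (subst Bochner_Integration.integral_sum) (simp_all only: scaled integral_mult_right_zero)
  also have "\<dots> = 0" using cross(2) by (simp cong: sum.cong)
  also have "expectation (\<lambda>w. cosh (?r w) * cosh c) = expectation (\<lambda>w. cosh (?r w)) * cosh c"
    by simp
  also have "\<dots> \<le> cosh c ^ card I * cosh c" using IH by (intro mult_right_mono) auto
  finally show ?case using L insert.hyps by (simp add: mult.commute)
qed


text \<open>A Hoeffding inequality for the Euclidean norm (a special case of Pinelis' inequality): Markov's
inequality for the hyperbolic cosine of a multiple of the norm, with the multiple optimised.\<close>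

lemma (in prob_space) prob_L2_set_sum_ge:
  fixes Y :: "'l \<Rightarrow> 'b \<Rightarrow> real" and c u :: real
  assumes "finite L" "finite I" "I \<noteq> {}" "indep_vars (\<lambda>_. N) X I" "0 < c" "0 \<le> u"
    and Y: "\<And>l. l \<in> L \<Longrightarrow> Y l \<in> borel_measurable N"
    and bnd: "\<And>i. i \<in> I \<Longrightarrow> AE w in M. L2_set (\<lambda>l. Y l (X i w)) L \<le> c"
    and cen: "\<And>i l. i \<in> I \<Longrightarrow> l \<in> L \<Longrightarrow> expectation (\<lambda>w. Y l (X i w)) = 0"
  shows "prob {w \<in> space M. u \<le> L2_set (\<lambda>l. \<Sum>i\<in>I. Y l (X i w)) L}
    \<le> 2 * exp (- u\<^sup>2 / (2 * card I * c\<^sup>2))"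
proof -
  let ?n = "real (card I)"
  have n: "?n > 0" using assms(2,3) by (simp add: card_gt_0_iff)
  \<comment> \<open>the minimiser of \<open>n t\<^sup>2 c\<^sup>2 / 2 - t u\<close>\<close>
  define t where "t = u / (?n * c\<^sup>2)"
  have t: "t \<ge> 0" using assms n by (simp add: t_def)
  have scale: "L2_set (\<lambda>l. t * f l) L = t * L2_set f L" for f
    using L2_set_right_distrib[OF t, of f L] by simp
  let ?r = "\<lambda>w. L2_set (\<lambda>l. \<Sum>i\<in>I. Y l (X i w)) L"
  have X: "X j \<in> measurable M N" if "j \<in> I" for j
    using assms(4) that by (auto simp: indep_vars_def)
  have YX: "(\<lambda>w. Y l (X j w)) \<in> borel_measurable M" if "j \<in> I" "l \<in> L" for j l
    using measurable_compose[OF X Y] that by auto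
  have r[measurable]: "?r \<in> borel_measurable M"
    using assms(1) YX by measurable
  have "integrable M (\<lambda>w. cosh (L2_set (\<lambda>l. \<Sum>i\<in>I. t * Y l (X i w)) L)) \<and>
    expectation (\<lambda>w. cosh (L2_set (\<lambda>l. \<Sum>i\<in>I. t * Y l (X i w)) L)) \<le> cosh (t * c) ^ card I"
  proof (rule expectation_cosh_L2_set_sum_le[OF assms(1,2,4)])
    show "AE w in M. L2_set (\<lambda>l. t * Y l (X i w)) L \<le> t * c" if "i \<in> I" for i
      using bnd[OF that] by eventually_elim (use t in \<open>auto simp: scale intro!: mult_left_mono\<close>)
  qed (use Y cen in auto)
  then have E: "integrable M (\<lambda>w. cosh (t * ?r w))"
    "expectation (\<lambda>w. cosh (t * ?r w)) \<le> cosh (t * c) ^ card I"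
    by (simp_all add: scale flip: sum_distrib_left)
  have "prob {w \<in> space M. u \<le> ?r w} \<le> prob {w \<in> space M. cosh (t * u) \<le> cosh (t * ?r w)}"
  proof (rule finite_measure_mono)
    show "{w \<in> space M. cosh (t * u) \<le> cosh (t * ?r w)} \<in> events"
      unfolding cosh_def by measurable
    show "{w \<in> space M. u \<le> ?r w} \<subseteq> {w \<in> space M. cosh (t * u) \<le> cosh (t * ?r w)}"
      using t assms(6) by (auto simp: cosh_real_nonneg_le_iff intro!: mult_left_mono)
  qed
  also have "\<dots> \<le> expectation (\<lambda>w. cosh (t * ?r w)) / cosh (t * u)"
    by (rule integral_Markov_inequality_measure[OF E(1)]) auto
  also have "\<dots> \<le> cosh (t * c) ^ card I / cosh (t * u)"
    using E(2) by (intro divide_right_mono) auto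
  also have "\<dots> \<le> exp ((t * c)\<^sup>2 / 2) ^ card I / (exp (t * u) / 2)"
  proof (rule frac_le)
    show "cosh (t * c) ^ card I \<le> exp ((t * c)\<^sup>2 / 2) ^ card I"
      by (intro power_mono cosh_le_exp_half_square) auto
    show "exp (t * u) / 2 \<le> cosh (t * u)" by (simp add: cosh_def)
  qed auto
  also have "\<dots> = 2 * exp (?n * ((t * c)\<^sup>2 / 2) - t * u)"
    by (simp only: exp_of_nat_mult exp_diff) simp
  also have "?n * ((t * c)\<^sup>2 / 2) - t * u = - u\<^sup>2 / (2 * card I * c\<^sup>2)"
    using n assms(5) by (simp add: t_def field_simps power2_eq_square)
  finally show ?thesis .
qed

lemma exp_le_one_plus_square:
  fixes x :: real
  assumes "\<bar>x\<bar> \<le> 1"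
  shows "exp x \<le> 1 + x + x\<^sup>2"
proof (cases "0 \<le> x")
  case True
  then show ?thesis using assms exp_bound[of x] by auto
next
  case False
  define y where "y = - x"
  have y: "0 \<le> y" "y \<le> 1" using False assms by (auto simp: y_def)
  have "exp x = 1 / exp y" by (simp add: y_def exp_minus field_simps)
  also have "\<dots> \<le> 1 / (1 + y + y\<^sup>2 / 2)"
    using exp_lower_Taylor_quadratic[OF y(1)] y by (intro divide_left_mono mult_pos_pos) (auto simp: add_pos_nonneg)
  also have "\<dots> \<le> 1 - y + y\<^sup>2"
  proof -
    have "(1 - y + y\<^sup>2) * (1 + y + y\<^sup>2 / 2) = 1 + y\<^sup>2 / 2 * (1 + y + y\<^sup>2)"
      by (simp add: field_simps power2_eq_square)
    also have "\<dots> \<ge> 1" using y by simp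
    finally show ?thesis using y by (simp add: divide_le_eq add_pos_nonneg)
  qed
  finally show ?thesis by (simp add: y_def)
qed

text \<open>The Bernstein bound before the choice of its parameter: the range enters only through the condition
\<open>a \<bar>g\<bar> \<le> 1\<close>, and the exponent has the variance in place of the squared range.\<close>

lemma (in prob_space) prob_sum_ge_exp:
  fixes g :: "'b \<Rightarrow> real" and a u v :: real
  assumes "finite I" "indep_vars (\<lambda>_. N) X I" "0 < a"
    and g[measurable]: "g \<in> borel_measurable N"
    and bnd: "\<And>i. i \<in> I \<Longrightarrow> AE w in M. a * \<bar>g (X i w)\<bar> \<le> 1"
    and cen: "\<And>i. i \<in> I \<Longrightarrow> expectation (\<lambda>w. g (X i w)) = 0"
    and var: "\<And>i. i \<in> I \<Longrightarrow> expectation (\<lambda>w. (g (X i w))\<^sup>2) \<le> v"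
  shows "prob {w \<in> space M. u \<le> (\<Sum>i\<in>I. g (X i w))} \<le> exp (card I * (a\<^sup>2 * v) - a * u)"
proof -
  have X[measurable]: "X j \<in> measurable M N" if "j \<in> I" for j
    using assms(2) that by (auto simp: indep_vars_def)
  have gX[measurable]: "(\<lambda>w. g (X j w)) \<in> borel_measurable M" if "j \<in> I" for j
    using measurable_compose[OF X g] that by auto
  have ind: "indep_vars (\<lambda>_. borel) (\<lambda>i w. exp (a * g (X i w))) I"
    by (rule indep_vars_compose2[OF assms(2)]) measurable
  have b: "AE w in M. \<bar>g (X i w)\<bar> \<le> 1 / a" if "i \<in> I" for i
    using bnd[OF that] by eventually_elim (use assms(3) in \<open>simp add: field_simps\<close>)
  have gi: "integrable M (\<lambda>w. g (X i w))" if i: "i \<in> I" for i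
    by (rule integrable_const_bound[where B = "1 / a"]) (use b[OF i] gX[OF i] in auto)
  have gi2: "integrable M (\<lambda>w. (g (X i w))\<^sup>2)" if i: "i \<in> I" for i
  proof (rule integrable_const_bound[where B = "(1 / a)\<^sup>2"])
    show "AE w in M. norm ((g (X i w))\<^sup>2) \<le> (1 / a)\<^sup>2"
      using b[OF i] by eventually_elim (metis norm_power power_mono norm_ge_zero real_norm_def)
  qed (use gX[OF i] in auto)
  have ei: "integrable M (\<lambda>w. exp (a * g (X i w)))" if i: "i \<in> I" for i
  proof (rule integrable_const_bound[where B = "exp 1"])
    show "AE w in M. norm (exp (a * g (X i w))) \<le> exp 1"
      using bnd[OF i]
    proof eventually_elim
      case (elim w)
      have "a * g (X i w) \<le> a * \<bar>g (X i w)\<bar>" using assms(3) by (intro mult_left_mono) auto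
      with elim show ?case by simp
    qed
  qed (use gX[OF i] in auto)
  have ee: "expectation (\<lambda>w. exp (a * g (X i w))) \<le> exp (a\<^sup>2 * v)" if i: "i \<in> I" for i
  proof -
    have "expectation (\<lambda>w. exp (a * g (X i w)))
        \<le> expectation (\<lambda>w. 1 + a * g (X i w) + a\<^sup>2 * (g (X i w))\<^sup>2)"
    proof (rule integral_mono_AE[OF ei[OF i]])
      show "integrable M (\<lambda>w. 1 + a * g (X i w) + a\<^sup>2 * (g (X i w))\<^sup>2)"
        using gi[OF i] gi2[OF i] by auto
      show "AE w in M. exp (a * g (X i w)) \<le> 1 + a * g (X i w) + a\<^sup>2 * (g (X i w))\<^sup>2"
        using bnd[OF i]
      proof eventually_elim
        case (elim w)
        then have "\<bar>a * g (X i w)\<bar> \<le> 1" using assms(3) by (simp add: abs_mult)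
        from exp_le_one_plus_square[OF this] show ?case by (simp add: power_mult_distrib)
      qed
    qed
    also have "\<dots> = 1 + a\<^sup>2 * expectation (\<lambda>w. (g (X i w))\<^sup>2)"
      using gi[OF i] gi2[OF i] cen[OF i] by (simp add: prob_space)
    also have "\<dots> \<le> 1 + a\<^sup>2 * v" using var[OF i] by (intro add_left_mono mult_left_mono) auto
    also have "\<dots> \<le> exp (a\<^sup>2 * v)" by (rule exp_ge_add_one_self)
    finally show ?thesis .
  qed
  have int: "integrable M (\<lambda>w. \<Prod>i\<in>I. exp (a * g (X i w)))"
    by (rule indep_vars_integrable[OF assms(1) ind ei])
  have "prob {w \<in> space M. u \<le> (\<Sum>i\<in>I. g (X i w))}
      = prob {w \<in> space M. exp (a * u) \<le> (\<Prod>i\<in>I. exp (a * g (X i w)))}"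
    using assms(1,3) by (simp flip: exp_sum sum_distrib_left)
  also have "\<dots> \<le> expectation (\<lambda>w. \<Prod>i\<in>I. exp (a * g (X i w))) / exp (a * u)"
    by (rule integral_Markov_inequality_measure[OF int]) (auto intro!: AE_I2 prod_nonneg)
  also have "expectation (\<lambda>w. \<Prod>i\<in>I. exp (a * g (X i w))) = (\<Prod>i\<in>I. expectation (\<lambda>w. exp (a * g (X i w))))"
    by (rule indep_vars_lebesgue_integral[OF assms(1) ind ei])
  also have "(\<Prod>i\<in>I. expectation (\<lambda>w. exp (a * g (X i w)))) \<le> (\<Prod>i\<in>I. exp (a\<^sup>2 * v))"
    using ee by (intro prod_mono) auto
  also have "\<dots> = exp (card I * (a\<^sup>2 * v))" by (simp add: exp_of_nat_mult)
  finally show ?thesis by (simp add: exp_diff divide_right_mono)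
qed

section \<open>Orthonormal families and their spans\<close>

interpretation fun_space: vector_space fun_scale
  by (rule vector_space_fun_scale)

interpretation unit_lborel: prob_space unit_lborel
  by (intro prob_spaceI) (simp add: space_restrict_space emeasure_restrict_space)

definition lin_comb :: "('l \<Rightarrow> real \<Rightarrow> real) \<Rightarrow> 'l set \<Rightarrow> ('l \<Rightarrow> real) \<Rightarrow> real \<Rightarrow> real" where
  "lin_comb \<phi> L a = (\<lambda>y. \<Sum>l\<in>L. a l * \<phi> l y)"

lemma L2_measurable [measurable_dest]: "f \<in> L2 \<Longrightarrow> f \<in> borel_measurable unit_lborel"
  by (simp add: L2_def)

text \<open>From \<open>\<bar>f g\<bar> \<le> f\<^sup>2 + g\<^sup>2\<close>.\<close>

lemma L2_integrable_mult:
  assumes "f \<in> L2" "g \<in> L2"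
  shows "integrable unit_lborel (\<lambda>x. f x * g x)"
proof (rule Bochner_Integration.integrable_bound)
  show "integrable unit_lborel (\<lambda>x. (f x)\<^sup>2 + (g x)\<^sup>2)"
    using assms by (auto simp: L2_def)
  show "(\<lambda>x. f x * g x) \<in> borel_measurable unit_lborel"
    using assms by (auto simp: L2_def)
  have "\<bar>a * b\<bar> \<le> a\<^sup>2 + b\<^sup>2" for a b :: real
  proof -
    have "0 \<le> (\<bar>a\<bar> - \<bar>b\<bar>)\<^sup>2" by simp
    then have "2 * (\<bar>a\<bar> * \<bar>b\<bar>) \<le> a\<^sup>2 + b\<^sup>2" by (simp add: power2_diff)
    moreover have "0 \<le> \<bar>a\<bar> * \<bar>b\<bar>" by simp
    ultimately show ?thesis unfolding abs_mult by linarith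
  qed
  then show "AE x in unit_lborel. norm (f x * g x) \<le> norm ((f x)\<^sup>2 + (g x)\<^sup>2)"
    by (intro AE_I2) (auto intro: order_trans)
qed

lemma L2_integrable: "f \<in> L2 \<Longrightarrow> integrable unit_lborel f"
  by (rule unit_lborel.square_integrable_imp_integrable) (auto simp: L2_def)

lemma L2_add: "f \<in> L2 \<Longrightarrow> g \<in> L2 \<Longrightarrow> (\<lambda>x. f x + g x) \<in> L2"
  using L2_integrable_mult[of f g]
  by (auto simp: L2_def power2_sum mult.assoc)

lemma L2_scale: "f \<in> L2 \<Longrightarrow> (\<lambda>x. c * f x) \<in> L2"
  by (auto simp: L2_def power_mult_distrib)

lemma L2_lin_comb: "(\<And>l. l \<in> L \<Longrightarrow> \<phi> l \<in> L2) \<Longrightarrow> lin_comb \<phi> L a \<in> L2"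
  unfolding lin_comb_def
proof (induction L rule: infinite_finite_induct)
  case (insert l L)
  then show ?case by (simp add: L2_add L2_scale)
qed (auto simp: L2_def)

lemma L2_norm_square: "(L2_norm f)\<^sup>2 = L2_inner f f"
  by (simp add: L2_norm_def L2_inner_def power2_eq_square)

lemma L2_inner_commute: "L2_inner f g = L2_inner g f"
  by (simp add: L2_inner_def mult.commute)

lemma L2_inner_add: "f \<in> L2 \<Longrightarrow> g \<in> L2 \<Longrightarrow> h \<in> L2 \<Longrightarrow>
    L2_inner (\<lambda>x. f x + g x) h = L2_inner f h + L2_inner g h"
  using L2_integrable_mult[of f h] L2_integrable_mult[of g h]
  by (simp add: L2_inner_def distrib_right)

lemma L2_inner_scale: "L2_inner (\<lambda>x. c * f x) g = c * L2_inner f g"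
  by (simp add: L2_inner_def mult.assoc)

lemma L2_inner_diff: "f \<in> L2 \<Longrightarrow> g \<in> L2 \<Longrightarrow> h \<in> L2 \<Longrightarrow>
    L2_inner (\<lambda>x. f x - g x) h = L2_inner f h - L2_inner g h"
  using L2_integrable_mult[of f h] L2_integrable_mult[of g h]
  by (simp add: L2_inner_def left_diff_distrib)

lemma L2_diff: "f \<in> L2 \<Longrightarrow> g \<in> L2 \<Longrightarrow> (\<lambda>x. f x - g x) \<in> L2"
  using L2_add[of f "\<lambda>x. (-1) * g x"] L2_scale[of g "-1"] by simp

lemma L2_inner_lin_comb:
  assumes "\<And>l. l \<in> L \<Longrightarrow> \<phi> l \<in> L2" "g \<in> L2"
  shows "L2_inner (lin_comb \<phi> L a) g = (\<Sum>l\<in>L. a l * L2_inner (\<phi> l) g)"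
  using assms(1)
proof (induction L rule: infinite_finite_induct)
  case (insert l L)
  have "lin_comb \<phi> (insert l L) a = (\<lambda>x. a l * \<phi> l x + lin_comb \<phi> L a x)"
    using insert.hyps by (simp add: lin_comb_def)
  with insert assms(2) show ?case
    by (simp add: L2_inner_add L2_inner_scale L2_scale L2_lin_comb)
qed (simp_all add: lin_comb_def L2_inner_def)

locale orthonormal =
  fixes \<phi> :: "'l \<Rightarrow> real \<Rightarrow> real" and L :: "'l set"
  assumes finite_L [simp]: "finite L"
    and orthonormal: "orthonormal_family \<phi> L"
begin

lemma \<phi>_L2 [simp]: "l \<in> L \<Longrightarrow> \<phi> l \<in> L2"
  using orthonormal by (simp add: orthonormal_family_def)

lemma inner_\<phi>: "l \<in> L \<Longrightarrow> k \<in> L \<Longrightarrow> L2_inner (\<phi> l) (\<phi> k) = (if l = k then 1 else 0)"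
  using orthonormal by (simp add: orthonormal_family_def)

lemma lin_comb_L2 [simp]: "lin_comb \<phi> L a \<in> L2"
  by (rule L2_lin_comb) simp

lemma inner_lin_comb_\<phi>: "k \<in> L \<Longrightarrow> L2_inner (lin_comb \<phi> L a) (\<phi> k) = a k"
  by (simp add: L2_inner_lin_comb inner_\<phi> if_distrib cong: if_cong)

lemma inner_lin_comb: "f \<in> L2 \<Longrightarrow> L2_inner f (lin_comb \<phi> L a) = (\<Sum>l\<in>L. a l * L2_inner f (\<phi> l))"
  by (subst L2_inner_commute) (simp add: L2_inner_lin_comb L2_inner_commute[of f])

lemma norm_lin_comb: "(L2_norm (lin_comb \<phi> L a))\<^sup>2 = (\<Sum>l\<in>L. (a l)\<^sup>2)"
  unfolding L2_norm_square by (simp add: inner_lin_comb inner_lin_comb_\<phi> power2_eq_square)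

lemma norm_diff_lin_comb:
  assumes "f \<in> L2"
  shows "(L2_norm (\<lambda>y. f y - lin_comb \<phi> L a y))\<^sup>2
    = (L2_norm f)\<^sup>2 - 2 * (\<Sum>l\<in>L. a l * L2_inner f (\<phi> l)) + (\<Sum>l\<in>L. (a l)\<^sup>2)"
proof -
  have "(L2_norm (\<lambda>y. f y - lin_comb \<phi> L a y))\<^sup>2
      = L2_inner f (\<lambda>y. f y - lin_comb \<phi> L a y)
        - L2_inner (lin_comb \<phi> L a) (\<lambda>y. f y - lin_comb \<phi> L a y)"
    using assms by (simp add: L2_norm_square L2_inner_diff L2_diff)
  also have "\<dots> = L2_inner f f - 2 * L2_inner f (lin_comb \<phi> L a)
      + L2_inner (lin_comb \<phi> L a) (lin_comb \<phi> L a)"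
    using assms L2_inner_commute[of f "\<lambda>y. f y - lin_comb \<phi> L a y"] L2_inner_commute[of "lin_comb \<phi> L a" f]
      L2_inner_commute[of "lin_comb \<phi> L a" "\<lambda>y. f y - lin_comb \<phi> L a y"]
    by (simp add: L2_inner_diff)
  finally show ?thesis
    using assms by (simp add: norm_lin_comb inner_lin_comb flip: L2_norm_square)
qed

lemma inj_on_\<phi>: "inj_on \<phi> L"
proof (rule inj_onI)
  fix l k assume "l \<in> L" "k \<in> L" "\<phi> l = \<phi> k"
  with inner_\<phi>[of l l] inner_\<phi>[of l k] show "l = k" by (auto split: if_splits)
qed

lemma sum_fun_scale: "(\<Sum>l\<in>L. fun_scale (a l) (\<phi> l)) = lin_comb \<phi> L a"
proof -
  have "(\<Sum>l\<in>K. fun_scale (a l) (\<phi> l)) = lin_comb \<phi> K a" if "finite K" for K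
    using that by induction (auto simp: lin_comb_def fun_scale_def fun_eq_iff)
  then show ?thesis by simp
qed

lemma model_span_eq: "model_span \<phi> L = range (lin_comb \<phi> L)"
proof
  show "model_span \<phi> L \<subseteq> range (lin_comb \<phi> L)"
  proof
    fix t assume "t \<in> model_span \<phi> L"
    then obtain u where "t = (\<Sum>v\<in>\<phi> ` L. fun_scale (u v) v)"
      unfolding model_span_def by (auto simp: fun_space.span_finite)
    also have "\<dots> = lin_comb \<phi> L (\<lambda>l. u (\<phi> l))"
      by (simp add: sum.reindex[OF inj_on_\<phi>] flip: sum_fun_scale)
    finally show "t \<in> range (lin_comb \<phi> L)" by simp
  qed
  show "range (lin_comb \<phi> L) \<subseteq> model_span \<phi> L"
  proof safe
    fix a
    have "fun_scale (a l) (\<phi> l) \<in> model_span \<phi> L" if "l \<in> L" for l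
      using that unfolding model_span_def by (intro fun_space.span_scale fun_space.span_base) auto
    then show "lin_comb \<phi> L a \<in> model_span \<phi> L"
      unfolding sum_fun_scale[symmetric] unfolding model_span_def by (rule fun_space.span_sum)
  qed
qed

lemma model_dim_eq: "model_dim \<phi> L = card L"
proof -
  have scalars: "u x = 0" if u: "(\<Sum>x\<in>\<phi> ` L. fun_scale (u x) x) = 0" and x: "x \<in> \<phi> ` L" for u x
  proof -
    from x obtain k where k: "k \<in> L" "x = \<phi> k" by auto
    from u have "lin_comb \<phi> L (\<lambda>l. u (\<phi> l)) = 0"
      by (simp add: sum.reindex[OF inj_on_\<phi>] flip: sum_fun_scale)
    with inner_lin_comb_\<phi>[OF k(1), of "\<lambda>l. u (\<phi> l)"] show "u x = 0"
      by (simp add: k L2_inner_def)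
  qed
  have "fun_space.independent (\<phi> ` L)"
    by (rule fun_space.independent_if_scalars_zero) (simp, rule scalars)
  from fun_space.dim_span_eq_card_independent[OF this] show ?thesis
    by (simp add: model_dim_def model_span_def card_image inj_on_\<phi>)
qed

text \<open>The coefficients of an element of the span are its inner products with the family, so the choice in
\<open>L2_proj\<close> is unique as a function and not only almost everywhere.\<close>

lemma model_proj_eq:
  assumes "f \<in> L2"
  shows "model_proj \<phi> L f = lin_comb \<phi> L (\<lambda>l. L2_inner f (\<phi> l))"
  unfolding model_proj_def L2_proj_def
proof (rule some_equality)
  show "lin_comb \<phi> L (\<lambda>l. L2_inner f (\<phi> l)) \<in> model_span \<phi> L \<and>
    (\<forall>u\<in>model_span \<phi> L. L2_inner (\<lambda>x. f x - lin_comb \<phi> L (\<lambda>l. L2_inner f (\<phi> l)) x) u = 0)"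
    using assms
    by (auto simp: model_span_eq inner_lin_comb L2_diff L2_inner_diff inner_lin_comb_\<phi> intro!: sum.neutral)
next
  fix t assume t: "t \<in> model_span \<phi> L \<and> (\<forall>u\<in>model_span \<phi> L. L2_inner (\<lambda>x. f x - t x) u = 0)"
  then obtain a where a: "t = lin_comb \<phi> L a" by (auto simp: model_span_eq)
  have "a l = L2_inner f (\<phi> l)" if "l \<in> L" for l
  proof -
    have "\<phi> l \<in> model_span \<phi> L"
      using that unfolding model_span_def by (intro fun_space.span_base) auto
    with t have "L2_inner (\<lambda>x. f x - t x) (\<phi> l) = 0" by blast
    with assms that show ?thesis
      by (simp add: a L2_inner_diff inner_lin_comb_\<phi>)
  qed
  then show "t = lin_comb \<phi> L (\<lambda>l. L2_inner f (\<phi> l))"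
    by (auto simp: a lin_comb_def)
qed

lemma bias2_eq:
  assumes "f \<in> L2"
  shows "bias2 f \<phi> L = (L2_norm f)\<^sup>2 - (\<Sum>l\<in>L. (L2_inner f (\<phi> l))\<^sup>2)"
  unfolding bias2_def model_proj_eq[OF assms] norm_diff_lin_comb[OF assms]
  by (simp add: power2_eq_square)

lemma bessel: "f \<in> L2 \<Longrightarrow> (\<Sum>l\<in>L. (L2_inner f (\<phi> l))\<^sup>2) \<le> (L2_norm f)\<^sup>2"
  using bias2_eq[of f] by (simp add: bias2_def) (smt (verit) zero_le_power2)

lemma L2_mem_span_imp_AE_eq_proj:
  assumes "f \<in> L2" "L2_mem f (model_span \<phi> L)"
  shows "AE x in unit_lborel. f x = model_proj \<phi> L f x"
proof -
  obtain a where a: "AE x in unit_lborel. f x = lin_comb \<phi> L a x"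
    using assms(2) by (auto simp: L2_mem_def model_span_eq)
  have "L2_inner f (\<phi> l) = a l" if l: "l \<in> L" for l
  proof -
    have "L2_inner f (\<phi> l) = L2_inner (lin_comb \<phi> L a) (\<phi> l)"
      unfolding L2_inner_def
    proof (rule integral_cong_AE)
      show "AE x in unit_lborel. f x * \<phi> l x = lin_comb \<phi> L a x * \<phi> l x"
        using a by eventually_elim simp
    qed (use assms(1) l in \<open>auto intro!: borel_measurable_times intro: L2_measurable\<close>)
    with l show ?thesis by (simp add: inner_lin_comb_\<phi>)
  qed
  then have "lin_comb \<phi> L a = model_proj \<phi> L f"
    by (auto simp: model_proj_eq[OF assms(1)] lin_comb_def)
  with a show ?thesis by simp
qed

lemma bias2_eq_0:
  assumes "f \<in> L2" "L2_mem f (model_span \<phi> L)"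
  shows "bias2 f \<phi> L = 0"
proof -
  have "AE x in unit_lborel. (f x - model_proj \<phi> L f x)\<^sup>2 = 0"
    using L2_mem_span_imp_AE_eq_proj[OF assms] by eventually_elim simp
  then show ?thesis unfolding bias2_def L2_norm_def
    by (simp add: integral_eq_zero_AE)
qed

lemma model_phi_bound:
  assumes "card L > 0"
    and "Linf_norm (model_phi \<phi> L) / ereal (real (model_dim \<phi> L)) \<le> ereal C"
  shows "AE x in unit_lborel. model_phi \<phi> L x \<le> C * card L"
proof -
  have le: "Linf_norm (model_phi \<phi> L) \<le> ereal (C * card L)"
    using assms by (simp add: model_dim_eq ereal_divide_le_pos mult.commute)
  have "AE x in unit_lborel. ereal \<bar>model_phi \<phi> L x\<bar> \<le> Linf_norm (model_phi \<phi> L)"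
    unfolding Linf_norm_def by (rule esssup_AE)
  then show ?thesis
  proof eventually_elim
    case (elim x)
    from order_trans[OF this le] show ?case by simp
  qed
qed

lemma lin_comb_square_le: "(lin_comb \<phi> L a x)\<^sup>2 \<le> (\<Sum>l\<in>L. (a l)\<^sup>2) * model_phi \<phi> L x"
  unfolding lin_comb_def model_phi_def by (rule Cauchy_Schwarz_ineq_sum)

end

lemma proj_estimator_eq:
  "proj_estimator \<phi> L J x = lin_comb \<phi> L (\<lambda>l. (\<Sum>i\<in>J. \<phi> l (x i)) / card J)"
  by (simp add: proj_estimator_def lin_comb_def)

section \<open>Closed form of the leave-p-out risk\<close>

lemma card_subsets_disjoint:
  assumes "finite I" "J \<subseteq> I"
  shows "card {e. e \<subseteq> I \<and> card e = p \<and> e \<inter> J = {}} = (card I - card J) choose p"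
proof -
  have "{e. e \<subseteq> I \<and> card e = p \<and> e \<inter> J = {}} = {e. e \<subseteq> I - J \<and> card e = p}" by auto
  also have "card \<dots> = card (I - J) choose p" using assms(1) by (intro n_subsets) auto
  finally show ?thesis using assms by (simp add: card_Diff_subset finite_subset)
qed

text \<open>An index pair contributes once for every held-out set that avoids it.\<close>

lemma sum_hold_out:
  fixes f :: "nat \<Rightarrow> nat \<Rightarrow> real"
  assumes "p \<le> n"
  shows "(\<Sum>e | e \<subseteq> {1..n} \<and> card e = p. \<Sum>i\<in>{1..n} - e. \<Sum>j\<in>{1..n} - e. f i j)
    = (\<Sum>i\<in>{1..n}. \<Sum>j\<in>{1..n}. f i j * real ((n - card {i, j}) choose p))"
proof -
  let ?E = "{e. e \<subseteq> {1..n} \<and> card e = p}"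
  have fin: "finite ?E" by (rule finite_subset[of _ "Pow {1..n}"]) auto
  have "(\<Sum>i\<in>{1..n} - e. \<Sum>j\<in>{1..n} - e. f i j)
      = (\<Sum>i\<in>{1..n}. \<Sum>j\<in>{1..n}. if e \<inter> {i, j} = {} then f i j else 0)" for e
  proof -
    have "(\<Sum>i\<in>{1..n} - e. \<Sum>j\<in>{1..n} - e. f i j)
        = (\<Sum>i\<in>{1..n} - e. \<Sum>j\<in>{1..n}. if e \<inter> {i, j} = {} then f i j else 0)"
      by (intro sum.cong refl sum.mono_neutral_cong_left) auto
    also have "\<dots> = (\<Sum>i\<in>{1..n}. \<Sum>j\<in>{1..n}. if e \<inter> {i, j} = {} then f i j else 0)"
      by (rule sum.mono_neutral_left) auto
    finally show ?thesis .
  qed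
  then have "(\<Sum>e\<in>?E. \<Sum>i\<in>{1..n} - e. \<Sum>j\<in>{1..n} - e. f i j)
      = (\<Sum>e\<in>?E. \<Sum>i\<in>{1..n}. \<Sum>j\<in>{1..n}. if e \<inter> {i, j} = {} then f i j else 0)"
    by simp
  also have "\<dots> = (\<Sum>i\<in>{1..n}. \<Sum>e\<in>?E. \<Sum>j\<in>{1..n}. if e \<inter> {i, j} = {} then f i j else 0)"
    by (rule sum.swap)
  also have "\<dots> = (\<Sum>i\<in>{1..n}. \<Sum>j\<in>{1..n}. \<Sum>e\<in>?E. if e \<inter> {i, j} = {} then f i j else 0)"
    by (intro sum.cong refl sum.swap)
  also have "\<dots> = (\<Sum>i\<in>{1..n}. \<Sum>j\<in>{1..n}. f i j * real ((n - card {i, j}) choose p))"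
  proof (intro sum.cong refl)
    fix i j assume "i \<in> {1..n}" "j \<in> {1..n}"
    then have "{i, j} \<subseteq> {1..n}" by auto
    from card_subsets_disjoint[OF _ this, of p]
    have c: "card {e. e \<subseteq> {1..n} \<and> card e = p \<and> e \<inter> {i, j} = {}} = (n - card {i, j}) choose p"
      by simp
    have "(\<Sum>e\<in>?E. if e \<inter> {i, j} = {} then f i j else 0)
        = (\<Sum>e\<in>{e \<in> ?E. e \<inter> {i, j} = {}}. f i j)"
      by (rule sum.inter_filter[symmetric]) (rule fin)
    also have "\<dots> = f i j * real (card {e. e \<subseteq> {1..n} \<and> card e = p \<and> e \<inter> {i, j} = {}})"
      by (simp add: conj_assoc)
    finally show "(\<Sum>e\<in>?E. if e \<inter> {i, j} = {} then f i j else 0)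
        = f i j * real ((n - card {i, j}) choose p)"
      by (simp only: c)
  qed
  finally show ?thesis .
qed

context
  fixes n p :: nat and k :: real
  assumes np: "2 \<le> n" "1 \<le> p" "p \<le> n - 1"
    and k_def: "k = real (n - p)"
begin

lemma k_pos: "k \<ge> 1" and n_gt_1: "real n > 1"
  using np by (auto simp: k_def)

lemma choose_minus_1: "real ((n - 1) choose p) = real (n choose p) * (k / n)"
proof -
  have "real (n * ((n - 1) choose p)) = real ((n - p) * (n choose p))"
    by (simp only: binomial_absorb_comp)
  then show ?thesis using np by (simp add: field_simps k_def)
qed

lemma choose_minus_2: "real ((n - 2) choose p) = real (n choose p) * (k * (k - 1) / (n * (real n - 1)))"
proof -
  have "real ((n - 1) * ((n - 1 - 1) choose p)) = real ((n - 1 - p) * ((n - 1) choose p))"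
    by (simp only: binomial_absorb_comp)
  moreover have "n - 1 - 1 = n - 2" by simp
  moreover have "real (n - 1) = real n - 1" "real (n - 1 - p) = k - 1"
    using np by (auto simp: k_def)
  ultimately have "(real n - 1) * real ((n - 2) choose p) = (k - 1) * real ((n - 1) choose p)"
    by (simp only: of_nat_mult)
  then have "(real n - 1) * real ((n - 2) choose p) = (k - 1) * (real (n choose p) * (k / n))"
    unfolding choose_minus_1 .
  then show ?thesis using n_gt_1 by (simp add: field_simps)
qed

lemma sum_hold_out_square:
  fixes a :: "nat \<Rightarrow> real"
  defines "T \<equiv> \<Sum>i\<in>{1..n}. a i" and "Q \<equiv> \<Sum>i\<in>{1..n}. (a i)\<^sup>2"
  shows "(\<Sum>e | e \<subseteq> {1..n} \<and> card e = p. (\<Sum>i\<in>{1..n} - e. a i)\<^sup>2)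
    = real (n choose p) * (k / n * Q + k * (k - 1) / (n * (real n - 1)) * (T\<^sup>2 - Q))"
proof -
  have expand: "T\<^sup>2 * (C * E) + Q * (C * F - C * E) = C * (F * Q + E * (T\<^sup>2 - Q))" for C E F
    by (simp add: algebra_simps)
  let ?c1 = "real ((n - 1) choose p)" and ?c2 = "real ((n - 2) choose p)"
  have "(\<Sum>e | e \<subseteq> {1..n} \<and> card e = p. (\<Sum>i\<in>{1..n} - e. a i)\<^sup>2)
      = (\<Sum>e | e \<subseteq> {1..n} \<and> card e = p. \<Sum>i\<in>{1..n} - e. \<Sum>j\<in>{1..n} - e. a i * a j)"
    by (simp add: power2_eq_square sum_product)
  also have "\<dots> = (\<Sum>i\<in>{1..n}. \<Sum>j\<in>{1..n}. a i * a j * real ((n - card {i, j}) choose p))"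
    using np by (intro sum_hold_out) auto
  also have "\<dots> = (\<Sum>i\<in>{1..n}. \<Sum>j\<in>{1..n}. a i * a j * ?c2 + (if i = j then a i * a j * (?c1 - ?c2) else 0))"
    by (intro sum.cong refl) (auto simp: numeral_2_eq_2 algebra_simps)
  also have "\<dots> = (\<Sum>i\<in>{1..n}. \<Sum>j\<in>{1..n}. a i * a j * ?c2) + (\<Sum>i\<in>{1..n}. a i * a i * (?c1 - ?c2))"
    by (simp add: sum.distrib)
  also have "(\<Sum>i\<in>{1..n}. \<Sum>j\<in>{1..n}. a i * a j * ?c2) = T\<^sup>2 * ?c2"
    by (simp add: T_def power2_eq_square sum_product flip: sum_distrib_right)
  also have "(\<Sum>i\<in>{1..n}. a i * a i * (?c1 - ?c2)) = Q * (?c1 - ?c2)"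
    by (simp add: Q_def power2_eq_square flip: sum_distrib_right)
  finally show ?thesis
    unfolding choose_minus_1 choose_minus_2 expand .
qed

lemma sum_hold_out_linear:
  fixes a :: "nat \<Rightarrow> real"
  shows "(\<Sum>e | e \<subseteq> {1..n} \<and> card e = p. \<Sum>i\<in>{1..n} - e. a i)
    = real (n choose p) * (k / n * (\<Sum>i\<in>{1..n}. a i))"
proof -
  have "(\<Sum>e | e \<subseteq> {1..n} \<and> card e = p. \<Sum>i\<in>{1..n} - e. a i)
      = (\<Sum>e | e \<subseteq> {1..n} \<and> card e = p. \<Sum>i\<in>{1..n} - e. \<Sum>j\<in>{1..n} - e. if i = j then a i else 0)"
    by (intro sum.cong refl) auto
  also have "\<dots> = (\<Sum>i\<in>{1..n}. \<Sum>j\<in>{1..n}. (if i = j then a i else 0) * real ((n - card {i, j}) choose p))"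
    using np by (intro sum_hold_out) auto
  also have "\<dots> = (\<Sum>i\<in>{1..n}. \<Sum>j\<in>{1..n}. if i = j then a i * real ((n - 1) choose p) else 0)"
    by (intro sum.cong refl) auto
  also have "\<dots> = (\<Sum>i\<in>{1..n}. a i) * real ((n - 1) choose p)"
    by (simp flip: sum_distrib_right)
  finally show ?thesis unfolding choose_minus_1 by (simp only: ac_simps)
qed

text \<open>The contribution of one basis function, with \<open>a i\<close> its value at the observation \<open>i\<close>. Both terms are
quadratic in the training sum, because the sum over the held-out set is the total minus the training
sum.\<close>

lemma sum_hold_out_contrast:
  fixes a :: "nat \<Rightarrow> real"
  defines "T \<equiv> \<Sum>i\<in>{1..n}. a i" and "Q \<equiv> \<Sum>i\<in>{1..n}. (a i)\<^sup>2"
  shows "(\<Sum>e | e \<subseteq> {1..n} \<and> card e = p.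
        ((\<Sum>i\<in>{1..n} - e. a i) / k)\<^sup>2 - 2 / p * (((\<Sum>i\<in>{1..n} - e. a i) / k) * (\<Sum>i\<in>e. a i)))
    = real (n choose p) * (Q / (n * k) - (k + 1) / (k * n * (real n - 1)) * (T\<^sup>2 - Q))"
proof -
  let ?A = "\<lambda>e. \<Sum>i\<in>{1..n} - e. a i" and ?E = "{e. e \<subseteq> {1..n} \<and> card e = p}"
  let ?d = "n * (real n - 1)"
  have p: "real p = n - k" "real p > 0" using np by (auto simp: k_def)
  have nz: "k \<noteq> 0" "real n \<noteq> 0" "real n - 1 \<noteq> 0" "n - k \<noteq> 0" using k_pos n_gt_1 p by auto
  have "(\<Sum>i\<in>e. a i) = T - ?A e" if "e \<in> ?E" for e
    using that sum.subset_diff[of e "{1..n}" a] by (simp add: T_def)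
  moreover have "(A / k)\<^sup>2 - 2 / p * ((A / k) * (T - A)) = (1 / k\<^sup>2 + 2 / (p * k)) * A\<^sup>2 - 2 * T / (p * k) * A"
    for A
    using nz p(2) by (simp add: power2_eq_square field_simps)
  ultimately have "(\<Sum>e\<in>?E. (?A e / k)\<^sup>2 - 2 / p * ((?A e / k) * (\<Sum>i\<in>e. a i)))
      = (\<Sum>e\<in>?E. (1 / k\<^sup>2 + 2 / (p * k)) * (?A e)\<^sup>2 - 2 * T / (p * k) * ?A e)"
    by (intro sum.cong refl) (simp only:)
  also have "\<dots> = (1 / k\<^sup>2 + 2 / (p * k)) * (\<Sum>e\<in>?E. (?A e)\<^sup>2) - 2 * T / (p * k) * (\<Sum>e\<in>?E. ?A e)"
    by (simp only: sum_subtractf sum_distrib_left)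
  also have "\<dots> = (1 / k\<^sup>2 + 2 / (p * k)) *
        (real (n choose p) * (k / n * Q + k * (k - 1) / ?d * (T\<^sup>2 - Q)))
      - 2 * T / (p * k) * (real (n choose p) * (k / n * T))"
    by (simp only: sum_hold_out_square sum_hold_out_linear T_def Q_def)
  also have "\<dots> = real (n choose p) * ((1 / k\<^sup>2 + 2 / (p * k)) *
        (k / n * Q + k * (k - 1) / ?d * (T\<^sup>2 - Q)) - 2 * T / (p * k) * (k / n * T))"
    by (simp add: algebra_simps)
  also have "(1 / k\<^sup>2 + 2 / (p * k)) * (k / n * Q + k * (k - 1) / ?d * (T\<^sup>2 - Q))
        - 2 * T / (p * k) * (k / n * T)
      = Q / (n * k) - (k + 1) / (k * n * (real n - 1)) * (T\<^sup>2 - Q)"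
    unfolding p(1) using nz by (simp add: divide_simps) (simp add: algebra_simps power2_eq_square)
  finally show ?thesis .
qed

end

lemma (in orthonormal) lpo_risk_eq:
  fixes n p :: nat and k :: real
  assumes np: "2 \<le> n" "1 \<le> p" "p \<le> n - 1" and k_def: "k = real (n - p)"
  shows "lpo_risk \<phi> L n p x = (\<Sum>i\<in>{1..n}. model_phi \<phi> L (x i)) / (n * k)
    - (k + 1) / (k * n * (real n - 1)) *
        ((\<Sum>l\<in>L. (\<Sum>i\<in>{1..n}. \<phi> l (x i))\<^sup>2) - (\<Sum>i\<in>{1..n}. model_phi \<phi> L (x i)))"
proof -
  let ?E = "{e. e \<subseteq> {1..n} \<and> card e = p}"
  let ?A = "\<lambda>e l. (\<Sum>i\<in>{1..n} - e. \<phi> l (x i)) / k"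
  have p: "real p > 0" using np by simp
  have loss: "1 / real p * (\<Sum>i\<in>e. contrast (proj_estimator \<phi> L ({1..n} - e) x) (x i))
      = (\<Sum>l\<in>L. (?A e l)\<^sup>2 - 2 / p * (?A e l * (\<Sum>i\<in>e. \<phi> l (x i))))" if e: "e \<in> ?E" for e
  proof -
    have card: "card e = p" "real (card ({1..n} - e)) = k"
      using e by (auto simp: card_Diff_subset finite_subset k_def)
    have contrast: "contrast (proj_estimator \<phi> L ({1..n} - e) x) y
        = (\<Sum>l\<in>L. (?A e l)\<^sup>2) - 2 * (\<Sum>l\<in>L. ?A e l * \<phi> l y)" for y
      unfolding contrast_def proj_estimator_eq norm_lin_comb card by (simp only: lin_comb_def)
    have "(\<Sum>i\<in>e. contrast (proj_estimator \<phi> L ({1..n} - e) x) (x i))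
        = p * (\<Sum>l\<in>L. (?A e l)\<^sup>2) - 2 * (\<Sum>i\<in>e. \<Sum>l\<in>L. ?A e l * \<phi> l (x i))"
      by (simp only: contrast sum_subtractf sum_constant card sum_distrib_left[symmetric])
    also have "(\<Sum>i\<in>e. \<Sum>l\<in>L. ?A e l * \<phi> l (x i)) = (\<Sum>l\<in>L. ?A e l * (\<Sum>i\<in>e. \<phi> l (x i)))"
      by (subst sum.swap) (simp only: sum_distrib_left)
    finally show ?thesis
      using p by (simp add: sum_subtractf right_diff_distrib sum_distrib_left)
  qed
  have Q: "(\<Sum>l\<in>L. \<Sum>i\<in>{1..n}. (\<phi> l (x i))\<^sup>2) = (\<Sum>i\<in>{1..n}. model_phi \<phi> L (x i))"
    unfolding model_phi_def by (rule sum.swap)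
  have "lpo_risk \<phi> L n p x = 1 / real (n choose p) *
      (\<Sum>e\<in>?E. \<Sum>l\<in>L. (?A e l)\<^sup>2 - 2 / p * (?A e l * (\<Sum>i\<in>e. \<phi> l (x i))))"
    unfolding lpo_risk_def by (intro arg_cong2[where f="(*)"] refl sum.cong loss)
  also have "\<dots> = 1 / real (n choose p) *
      (\<Sum>l\<in>L. \<Sum>e\<in>?E. (?A e l)\<^sup>2 - 2 / p * (?A e l * (\<Sum>i\<in>e. \<phi> l (x i))))"
    by (subst sum.swap) (rule refl)
  also have "\<dots> = (\<Sum>l\<in>L. (\<Sum>i\<in>{1..n}. (\<phi> l (x i))\<^sup>2) / (n * k) - (k + 1) / (k * n * (real n - 1))
      * ((\<Sum>i\<in>{1..n}. \<phi> l (x i))\<^sup>2 - (\<Sum>i\<in>{1..n}. (\<phi> l (x i))\<^sup>2)))"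
    using np by (simp only: sum_hold_out_contrast[OF np k_def] flip: sum_distrib_left) simp
  also have "\<dots> = (\<Sum>i\<in>{1..n}. model_phi \<phi> L (x i)) / (n * k)
    - (k + 1) / (k * n * (real n - 1)) *
        ((\<Sum>l\<in>L. (\<Sum>i\<in>{1..n}. \<phi> l (x i))\<^sup>2) - (\<Sum>i\<in>{1..n}. model_phi \<phi> L (x i)))"
    unfolding sum_subtractf Q[symmetric] sum_divide_distrib[symmetric] sum_distrib_left[symmetric] ..
  finally show ?thesis .
qed

text \<open>The closed form in terms of deviations from arbitrary constants \<open>c\<close>; with the true coefficients this
is the Hoeffding decomposition of the U-statistic into its constant, linear and degenerate parts.\<close>

lemma (in orthonormal) lpo_risk_centered:
  fixes n p :: nat and k :: real and c :: "'l \<Rightarrow> real" and x :: "nat \<Rightarrow> real"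
  assumes np: "2 \<le> n" "1 \<le> p" "p \<le> n - 1" and k_def: "k = real (n - p)"
  defines "S \<equiv> \<lambda>l. \<Sum>i\<in>{1..n}. \<phi> l (x i) - c l"
    and "q \<equiv> \<lambda>i. \<Sum>l\<in>L. (\<phi> l (x i) - c l)\<^sup>2"
  shows "lpo_risk \<phi> L n p x = (\<Sum>i\<in>{1..n}. model_phi \<phi> L (x i)) / n / k
    - (1 + 1 / k) * ((\<Sum>l\<in>L. (c l)\<^sup>2) + 2 / n * (\<Sum>l\<in>L. c l * S l)
        + ((\<Sum>l\<in>L. (S l)\<^sup>2) - (\<Sum>i\<in>{1..n}. q i)) / (n * (real n - 1)))"
proof -
  let ?C = "\<Sum>l\<in>L. (c l)\<^sup>2" and ?D = "\<Sum>l\<in>L. c l * S l" and ?F = "\<Sum>i\<in>{1..n}. model_phi \<phi> L (x i)"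
  have T: "(\<Sum>i\<in>{1..n}. \<phi> l (x i)) = S l + n * c l" for l
    by (simp add: S_def sum_subtractf)
  have "(\<Sum>l\<in>L. (\<Sum>i\<in>{1..n}. \<phi> l (x i))\<^sup>2)
      = (\<Sum>l\<in>L. (S l)\<^sup>2) + 2 * n * ?D + (real n)\<^sup>2 * ?C"
    unfolding T by (simp add: power2_sum power_mult_distrib sum.distrib sum_distrib_left ac_simps)
  moreover have "?F = (\<Sum>i\<in>{1..n}. q i) + 2 * ?D + n * ?C"
  proof -
    have "model_phi \<phi> L (x i) = q i + 2 * (\<Sum>l\<in>L. c l * (\<phi> l (x i) - c l)) + ?C" for i
      unfolding model_phi_def q_def sum_distrib_left sum.distrib[symmetric]
      by (intro sum.cong refl) (simp add: power2_eq_square algebra_simps)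
    then have "?F = (\<Sum>i\<in>{1..n}. q i) + 2 * (\<Sum>i\<in>{1..n}. \<Sum>l\<in>L. c l * (\<phi> l (x i) - c l)) + n * ?C"
      by (simp add: sum.distrib sum_distrib_left)
    also have "(\<Sum>i\<in>{1..n}. \<Sum>l\<in>L. c l * (\<phi> l (x i) - c l)) = ?D"
      by (subst sum.swap) (simp add: S_def sum_distrib_left)
    finally show ?thesis .
  qed
  ultimately have "(\<Sum>l\<in>L. (\<Sum>i\<in>{1..n}. \<phi> l (x i))\<^sup>2) - ?F
      = (\<Sum>l\<in>L. (S l)\<^sup>2) - (\<Sum>i\<in>{1..n}. q i) + 2 * (real n - 1) * ?D + n * (real n - 1) * ?C"
    by (simp add: power2_eq_square algebra_simps)
  then have "lpo_risk \<phi> L n p x = ?F / (n * k) - (k + 1) / (k * n * (real n - 1)) *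
      ((\<Sum>l\<in>L. (S l)\<^sup>2) - (\<Sum>i\<in>{1..n}. q i) + 2 * (real n - 1) * ?D + n * (real n - 1) * ?C)"
    by (simp only: lpo_risk_eq[OF np k_def])
  also have "\<dots> = ?F / n / k - (1 + 1 / k) * (?C + 2 / n * ?D
        + ((\<Sum>l\<in>L. (S l)\<^sup>2) - (\<Sum>i\<in>{1..n}. q i)) / (n * (real n - 1)))"
    using k_pos[OF np k_def] n_gt_1[OF np k_def] by (simp add: divide_simps) (simp add: algebra_simps)
  finally show ?thesis .
qed

section \<open>Moments and deviations for one model\<close>

locale density_sample = prob_space P for P :: "'w measure" +
  fixes X :: "nat \<Rightarrow> 'w \<Rightarrow> real" and n :: nat and s :: "real \<Rightarrow> real"
  assumes n_pos: "1 \<le> n"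
    and indep: "indep_vars (\<lambda>_. unit_lborel) X {1..n}"
    and density: "\<And>i. i \<in> {1..n} \<Longrightarrow> distributed P unit_lborel (X i) (\<lambda>x. ennreal (s x))"
    and s_nonneg: "\<And>x. x \<in> {0..1} \<Longrightarrow> 0 \<le> s x"
    and s_L2 [simp]: "s \<in> L2"
begin

lemma X_measurable [measurable]: "i \<in> {1..n} \<Longrightarrow> X i \<in> measurable P unit_lborel"
  using density by (rule distributed_measurable)

lemma AE_sample:
  assumes "AE x in unit_lborel. Q x" "i \<in> {1..n}"
  shows "AE w in P. Q (X i w)"
proof (rule AE_distrD[where f = "X i" and P = Q])
  show "X i \<in> measurable P unit_lborel" using assms(2) by (rule X_measurable)
  show "AE x in distr P unit_lborel (X i). Q x"
    unfolding distributed_distr_eq_density[OF density[OF assms(2)]]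
    using assms(1) distributed_borel_measurable[OF density[OF assms(2)]]
    by (subst AE_density) auto
qed

lemma expectation_sample:
  assumes "g \<in> borel_measurable unit_lborel" "i \<in> {1..n}"
  shows "expectation (\<lambda>w. g (X i w)) = L2_inner s g"
  unfolding L2_inner_def
  using distributed_integral[OF density[OF assms(2)] assms(1)] s_nonneg
  by (simp add: space_restrict_space)

lemma inner_const: "L2_inner s (\<lambda>_. c) = c"
  using expectation_sample[of "\<lambda>_. c" 1] n_pos by (simp add: prob_space)

lemma inner_mono_AE:
  assumes "integrable unit_lborel (\<lambda>x. s x * f x)" "integrable unit_lborel (\<lambda>x. s x * g x)"
    "AE x in unit_lborel. f x \<le> g x"
  shows "L2_inner s f \<le> L2_inner s g"
  unfolding L2_inner_def
proof (rule integral_mono_AE[OF assms(1,2)])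
  show "AE x in unit_lborel. s x * f x \<le> s x * g x"
    using assms(3) AE_space
    by eventually_elim (auto simp: space_restrict_space s_nonneg intro!: mult_left_mono)
qed

text \<open>Independence cancels the off-diagonal terms.\<close>

lemma expectation_centered_sum_square:
  assumes g: "g \<in> borel_measurable unit_lborel"
    and bnd: "AE x in unit_lborel. \<bar>g x\<bar> \<le> C"
    and cen: "L2_inner s g = 0"
  shows "integrable P (\<lambda>w. (\<Sum>i\<in>{1..n}. g (X i w))\<^sup>2)"
    and "expectation (\<lambda>w. (\<Sum>i\<in>{1..n}. g (X i w))\<^sup>2) = n * L2_inner s (\<lambda>x. (g x)\<^sup>2)"
proof -
  have gX [measurable]: "(\<lambda>w. g (X i w)) \<in> borel_measurable P" if "i \<in> {1..n}" for i
    using measurable_compose[OF X_measurable g] that by auto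
  have b: "AE w in P. \<bar>g (X i w)\<bar> \<le> C" if "i \<in> {1..n}" for i
    using AE_sample[OF bnd that] .
  have int: "integrable P (\<lambda>w. g (X i w))" if "i \<in> {1..n}" for i
    by (rule integrable_const_bound[where B = C]) (use b[OF that] gX[OF that] in auto)
  have prod: "integrable P (\<lambda>w. g (X i w) * g (X j w))" if "i \<in> {1..n}" "j \<in> {1..n}" for i j
  proof (rule integrable_const_bound[where B = "C * C"])
    show "AE w in P. norm (g (X i w) * g (X j w)) \<le> C * C"
      using b[OF that(1)] b[OF that(2)]
      by eventually_elim (auto simp: abs_mult intro!: mult_mono)
  qed (use gX that in auto)
  have E: "expectation (\<lambda>w. g (X i w) * g (X j w)) = (if i = j then L2_inner s (\<lambda>x. (g x)\<^sup>2) else 0)"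
    if ij: "i \<in> {1..n}" "j \<in> {1..n}" for i j
  proof (cases "i = j")
    case True
    then show ?thesis
      using expectation_sample[of "\<lambda>x. (g x)\<^sup>2" i] g ij by (simp add: power2_eq_square)
  next
    case False
    have "indep_vars (\<lambda>_. borel) (\<lambda>i w. g (X i w)) {i, j}"
      by (rule indep_vars_compose2[OF indep_vars_subset[OF indep]]) (use ij g in auto)
    then have "expectation (\<lambda>w. \<Prod>m\<in>{i, j}. g (X m w)) = (\<Prod>m\<in>{i, j}. expectation (\<lambda>w. g (X m w)))"
      by (rule indep_vars_lebesgue_integral[rotated]) (use int ij in auto)
    with False show ?thesis
      using expectation_sample[OF g ij(1)] by (simp add: cen)
  qed
  have sq: "(\<Sum>i\<in>{1..n}. g (X i w))\<^sup>2 = (\<Sum>i\<in>{1..n}. \<Sum>j\<in>{1..n}. g (X i w) * g (X j w))" for w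
    by (simp add: power2_eq_square sum_product)
  show "integrable P (\<lambda>w. (\<Sum>i\<in>{1..n}. g (X i w))\<^sup>2)"
    unfolding sq using prod by (intro Bochner_Integration.integrable_sum) auto
  have "expectation (\<lambda>w. (\<Sum>i\<in>{1..n}. g (X i w))\<^sup>2)
      = (\<Sum>i\<in>{1..n}. \<Sum>j\<in>{1..n}. expectation (\<lambda>w. g (X i w) * g (X j w)))"
    unfolding sq
  proof (subst Bochner_Integration.integral_sum)
    show "integrable P (\<lambda>w. \<Sum>j\<in>{1..n}. g (X i w) * g (X j w))" if "i \<in> {1..n}" for i
      using that by (intro Bochner_Integration.integrable_sum prod)
    show "(\<Sum>i\<in>{1..n}. expectation (\<lambda>w. \<Sum>j\<in>{1..n}. g (X i w) * g (X j w)))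
        = (\<Sum>i\<in>{1..n}. \<Sum>j\<in>{1..n}. expectation (\<lambda>w. g (X i w) * g (X j w)))"
      by (intro sum.cong refl Bochner_Integration.integral_sum prod)
  qed
  also have "\<dots> = (\<Sum>i\<in>{1..n}. \<Sum>j\<in>{1..n}. if i = j then L2_inner s (\<lambda>x. (g x)\<^sup>2) else 0)"
    by (intro sum.cong refl E)
  finally show "expectation (\<lambda>w. (\<Sum>i\<in>{1..n}. g (X i w))\<^sup>2) = n * L2_inner s (\<lambda>x. (g x)\<^sup>2)"
    by simp
qed

end

locale model_sample = density_sample P X n s + orthonormal \<phi> L
  for P :: "'w measure" and X n s and \<phi> :: "'l \<Rightarrow> real \<Rightarrow> real" and L +
  fixes \<Phi> :: real
  assumes card_pos: "card L > 0" and \<Phi>_pos: "\<Phi> > 0"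
    and phi_bound: "AE x in unit_lborel. model_phi \<phi> L x \<le> \<Phi> * card L"
begin

abbreviation "dm \<equiv> real (card L)"

text \<open>The Fourier coefficients of the density.\<close>

definition \<beta> :: "'l \<Rightarrow> real" where "\<beta> l = L2_inner s (\<phi> l)"

text \<open>\<open>n\<close> times the error of the empirical Fourier coefficients.\<close>

definition S :: "'w \<Rightarrow> 'l \<Rightarrow> real" where "S w l = (\<Sum>i\<in>{1..n}. \<phi> l (X i w) - \<beta> l)"

definition "mean_phi = L2_inner s (model_phi \<phi> L)"

text \<open>The sum over the family of the variances of \<open>\<phi> l (X i)\<close>.\<close>

definition "variance_sum = mean_phi - (\<Sum>l\<in>L. (\<beta> l)\<^sup>2)"

lemma dm_ge_1: "dm \<ge> 1" using card_pos by simp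

lemma \<phi>_measurable [measurable]: "l \<in> L \<Longrightarrow> \<phi> l \<in> borel_measurable unit_lborel"
  using \<phi>_L2 L2_measurable by blast

lemma model_phi_measurable [measurable]: "model_phi \<phi> L \<in> borel_measurable unit_lborel"
  unfolding model_phi_def by measurable

lemma \<phi>X_measurable [measurable]: "l \<in> L \<Longrightarrow> i \<in> {1..n} \<Longrightarrow> (\<lambda>w. \<phi> l (X i w)) \<in> borel_measurable P"
  using measurable_compose[OF X_measurable \<phi>_measurable] by blast

lemma S_measurable [measurable]: "l \<in> L \<Longrightarrow> (\<lambda>w. S w l) \<in> borel_measurable P"
  unfolding S_def by measurable

lemma model_phi_nonneg: "0 \<le> model_phi \<phi> L x"
  by (simp add: model_phi_def sum_nonneg)

lemma phi_sq_le: "l \<in> L \<Longrightarrow> (\<phi> l x)\<^sup>2 \<le> model_phi \<phi> L x"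
  unfolding model_phi_def by (rule member_le_sum) auto

lemma \<phi>_bounded: "l \<in> L \<Longrightarrow> AE x in unit_lborel. \<bar>\<phi> l x\<bar> \<le> sqrt (\<Phi> * dm)"
  using phi_bound
proof eventually_elim
  case (elim x)
  then have "(\<phi> l x)\<^sup>2 \<le> \<Phi> * dm" using phi_sq_le[of l x] by simp
  then show ?case by (metis real_sqrt_abs real_sqrt_le_mono)
qed

lemma s_mult_integrable:
  assumes g: "g \<in> borel_measurable unit_lborel" and bnd: "AE x in unit_lborel. \<bar>g x\<bar> \<le> C"
  shows "integrable unit_lborel (\<lambda>x. s x * g x)"
proof (rule Bochner_Integration.integrable_bound)
  show "integrable unit_lborel (\<lambda>x. C * s x)" using L2_integrable[OF s_L2] by simp
  show "(\<lambda>x. s x * g x) \<in> borel_measurable unit_lborel"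
    using g L2_measurable[OF s_L2] by measurable
  show "AE x in unit_lborel. norm (s x * g x) \<le> norm (C * s x)"
    using bnd by eventually_elim (auto simp: abs_mult mult.commute intro!: mult_mono)
qed

lemma s_mult_\<phi>_square_integrable:
  assumes "l \<in> L"
  shows "integrable unit_lborel (\<lambda>x. s x * (\<phi> l x)\<^sup>2)"
proof (rule s_mult_integrable[where C = "\<Phi> * dm"])
  show "AE x in unit_lborel. \<bar>(\<phi> l x)\<^sup>2\<bar> \<le> \<Phi> * dm"
    using phi_bound by eventually_elim (use phi_sq_le[OF assms] in \<open>auto intro: order_trans\<close>)
qed (use \<phi>_measurable[OF assms] in measurable)

lemma inner_bounded_mono:
  assumes "g \<in> borel_measurable unit_lborel" "AE x in unit_lborel. \<bar>g x\<bar> \<le> C"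
  shows "L2_inner s g \<le> C"
proof -
  have "L2_inner s g \<le> L2_inner s (\<lambda>_. C)"
  proof (rule inner_mono_AE)
    show "integrable unit_lborel (\<lambda>x. s x * g x)" by (rule s_mult_integrable) fact+
    show "integrable unit_lborel (\<lambda>x. s x * C)" using L2_integrable[OF s_L2] by simp
    show "AE x in unit_lborel. g x \<le> C" using assms(2) by eventually_elim auto
  qed
  then show ?thesis by (simp add: inner_const)
qed

lemma mean_phi_nonneg: "0 \<le> mean_phi"
  unfolding mean_phi_def L2_inner_def
  by (intro integral_nonneg_AE AE_I2)
     (auto simp: space_restrict_space intro!: mult_nonneg_nonneg s_nonneg model_phi_nonneg)

lemma mean_phi_le: "mean_phi \<le> \<Phi> * dm"
  unfolding mean_phi_def
  by (rule inner_bounded_mono) (use phi_bound model_phi_nonneg in auto)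

lemma expectation_S_square:
  assumes "l \<in> L"
  shows "integrable P (\<lambda>w. (S w l)\<^sup>2)"
    "expectation (\<lambda>w. (S w l)\<^sup>2) = n * (L2_inner s (\<lambda>x. (\<phi> l x)\<^sup>2) - (\<beta> l)\<^sup>2)"
proof -
  have int: "integrable unit_lborel (\<lambda>x. s x * (\<phi> l x)\<^sup>2)" "integrable unit_lborel (\<lambda>x. s x * \<phi> l x)"
    by (rule s_mult_\<phi>_square_integrable[OF assms],
        rule s_mult_integrable[OF \<phi>_measurable[OF assms] \<phi>_bounded[OF assms]])
  have s1: "integrable unit_lborel s" "LINT x|unit_lborel. s x = 1"
    using L2_integrable[OF s_L2] inner_const[of 1] by (simp_all add: L2_inner_def)
  have cen: "L2_inner s (\<lambda>x. \<phi> l x - \<beta> l) = 0"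
    using int s1 by (simp add: \<beta>_def L2_inner_def right_diff_distrib)
  have var: "L2_inner s (\<lambda>x. (\<phi> l x - \<beta> l)\<^sup>2) = L2_inner s (\<lambda>x. (\<phi> l x)\<^sup>2) - (\<beta> l)\<^sup>2"
  proof -
    have "L2_inner s (\<lambda>x. (\<phi> l x - \<beta> l)\<^sup>2)
        = (LINT x|unit_lborel. s x * (\<phi> l x)\<^sup>2 - 2 * \<beta> l * (s x * \<phi> l x) + (\<beta> l)\<^sup>2 * s x)"
      unfolding L2_inner_def by (intro Bochner_Integration.integral_cong refl)
        (simp add: power2_eq_square algebra_simps)
    also have "\<dots> = L2_inner s (\<lambda>x. (\<phi> l x)\<^sup>2) - 2 * \<beta> l * \<beta> l + (\<beta> l)\<^sup>2"
      using int s1 by (simp add: L2_inner_def[of s] \<beta>_def)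
    finally show ?thesis by (simp add: power2_eq_square)
  qed
  have m: "(\<lambda>x. \<phi> l x - \<beta> l) \<in> borel_measurable unit_lborel"
    using \<phi>_measurable[OF assms] by measurable
  have b: "AE x in unit_lborel. \<bar>\<phi> l x - \<beta> l\<bar> \<le> sqrt (\<Phi> * dm) + \<bar>\<beta> l\<bar>"
    using \<phi>_bounded[OF assms] by eventually_elim linarith
  show "integrable P (\<lambda>w. (S w l)\<^sup>2)"
    unfolding S_def by (rule expectation_centered_sum_square(1)[OF m b cen])
  show "expectation (\<lambda>w. (S w l)\<^sup>2) = n * (L2_inner s (\<lambda>x. (\<phi> l x)\<^sup>2) - (\<beta> l)\<^sup>2)"
    unfolding S_def expectation_centered_sum_square(2)[OF m b cen] var ..
qed

lemma expectation_chi: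
  "integrable P (\<lambda>w. \<Sum>l\<in>L. (S w l)\<^sup>2)"
  "expectation (\<lambda>w. \<Sum>l\<in>L. (S w l)\<^sup>2) = n * variance_sum"
proof -
  show "integrable P (\<lambda>w. \<Sum>l\<in>L. (S w l)\<^sup>2)"
    by (intro Bochner_Integration.integrable_sum expectation_S_square)
  have "expectation (\<lambda>w. \<Sum>l\<in>L. (S w l)\<^sup>2) = (\<Sum>l\<in>L. n * (L2_inner s (\<lambda>x. (\<phi> l x)\<^sup>2) - (\<beta> l)\<^sup>2))"
    by (simp add: Bochner_Integration.integral_sum expectation_S_square)
  also have "\<dots> = n * ((\<Sum>l\<in>L. L2_inner s (\<lambda>x. (\<phi> l x)\<^sup>2)) - (\<Sum>l\<in>L. (\<beta> l)\<^sup>2))"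
    by (simp only: sum_subtractf flip: sum_distrib_left)
  also have "(\<Sum>l\<in>L. L2_inner s (\<lambda>x. (\<phi> l x)\<^sup>2)) = mean_phi"
    unfolding mean_phi_def model_phi_def L2_inner_def sum_distrib_left
    using s_mult_\<phi>_square_integrable by (simp add: Bochner_Integration.integral_sum)
  finally show "expectation (\<lambda>w. \<Sum>l\<in>L. (S w l)\<^sup>2) = n * variance_sum"
    by (simp add: variance_sum_def)
qed

lemma model_proj_eq_\<beta>: "model_proj \<phi> L s = lin_comb \<phi> L \<beta>"
  unfolding model_proj_eq[OF s_L2] by (simp add: lin_comb_def \<beta>_def)

lemma proj_estimator_eq_S:
  "proj_estimator \<phi> L {1..n} (\<lambda>i. X i w) = lin_comb \<phi> L (\<lambda>l. \<beta> l + S w l / n)"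
proof -
  have "(\<Sum>i\<in>{1..n}. \<phi> l (X i w)) / card {1..n} = \<beta> l + S w l / n" for l
    using n_pos by (simp add: S_def sum_subtractf field_simps)
  then show ?thesis by (simp only: proj_estimator_eq)
qed

lemma norm_proj_diff:
  "(L2_norm (\<lambda>y. model_proj \<phi> L s y - proj_estimator \<phi> L {1..n} (\<lambda>i. X i w) y))\<^sup>2
    = (\<Sum>l\<in>L. (S w l)\<^sup>2) / n\<^sup>2"
proof -
  have "(\<lambda>y. model_proj \<phi> L s y - proj_estimator \<phi> L {1..n} (\<lambda>i. X i w) y)
      = lin_comb \<phi> L (\<lambda>l. - (S w l / n))"
    unfolding proj_estimator_eq_S model_proj_eq_\<beta>
    by (simp add: lin_comb_def fun_eq_iff algebra_simps flip: sum_subtractf sum.distrib sum_negf)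
  then show ?thesis
    by (simp add: norm_lin_comb power_divide sum_divide_distrib)
qed

text \<open>By Pythagoras the squared norm is the sum of the squared coefficient errors, and the expectation of
each of these is the variance of an empirical mean.\<close>

lemma est_error2_eq: "est_error2 P X n s \<phi> L = variance_sum / n"
  unfolding est_error2_def norm_proj_diff using expectation_chi n_pos
  by (simp add: power2_eq_square)

lemma bias2_eq_\<beta>: "bias2 s \<phi> L = (L2_norm s)\<^sup>2 - (\<Sum>l\<in>L. (\<beta> l)\<^sup>2)"
  by (simp add: bias2_eq \<beta>_def)

lemma quad_risk_eq: "quad_risk P X n s \<phi> L = bias2 s \<phi> L + variance_sum / n"
proof -
  have "(L2_norm (\<lambda>y. s y - proj_estimator \<phi> L {1..n} (\<lambda>i. X i w) y))\<^sup>2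
      = bias2 s \<phi> L + (\<Sum>l\<in>L. (S w l)\<^sup>2) / n\<^sup>2" for w
  proof -
    have "- 2 * (\<Sum>l\<in>L. (\<beta> l + S w l / n) * \<beta> l) + (\<Sum>l\<in>L. (\<beta> l + S w l / n)\<^sup>2)
        = (\<Sum>l\<in>L. (S w l)\<^sup>2 / n\<^sup>2) - (\<Sum>l\<in>L. (\<beta> l)\<^sup>2)"
      unfolding sum_distrib_left sum.distrib[symmetric] sum_subtractf[symmetric]
      by (intro sum.cong refl) (simp add: power2_sum power_divide algebra_simps power2_eq_square)
    then show ?thesis
      unfolding proj_estimator_eq_S norm_diff_lin_comb[OF s_L2] bias2_eq_\<beta> \<beta>_def[symmetric]
      by (simp add: sum_divide_distrib)
  qed
  then show ?thesis
    unfolding quad_risk_def using expectation_chi n_pos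
    by (simp add: power2_eq_square prob_space)
qed

lemma bias2_nonneg: "0 \<le> bias2 s \<phi> L"
  by (simp add: bias2_def)

lemma variance_sum_nonneg: "0 \<le> variance_sum"
proof -
  have "0 \<le> expectation (\<lambda>w. \<Sum>l\<in>L. (S w l)\<^sup>2)"
    by (intro integral_nonneg_AE AE_I2 sum_nonneg) auto
  then show ?thesis using n_pos by (simp add: expectation_chi zero_le_mult_iff)
qed

lemma sum_\<beta>_le: "(\<Sum>l\<in>L. (\<beta> l)\<^sup>2) \<le> \<Phi> * dm"
  using variance_sum_nonneg mean_phi_le by (simp add: variance_sum_def)

lemma est_error1_square_le: "(est_error1 P X n s \<phi> L)\<^sup>2 \<le> est_error2 P X n s \<phi> L"
proof -
  let ?Z = "\<lambda>w. L2_norm (\<lambda>y. model_proj \<phi> L s y - proj_estimator \<phi> L {1..n} (\<lambda>i. X i w) y)"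
  have Z: "?Z w = sqrt ((\<Sum>l\<in>L. (S w l)\<^sup>2) / n\<^sup>2)" for w
    unfolding norm_proj_diff[symmetric] by (simp add: L2_norm_def)
  have meas: "?Z \<in> borel_measurable P" unfolding Z by measurable
  have sq: "integrable P (\<lambda>w. (?Z w)\<^sup>2)"
    unfolding norm_proj_diff using expectation_chi by simp
  then have "integrable P ?Z" by (rule square_integrable_imp_integrable[OF meas])
  from variance_eq[OF this sq] variance_positive[of ?Z] show ?thesis
    by (simp add: est_error1_def est_error2_def)
qed

text \<open>A lower bound on the first moment of the estimation error gives one on the second moment by Jensen's
inequality.\<close>

lemma variance_sum_ge:
  assumes "\<xi> > 0" and "sqrt n * est_error1 P X n s \<phi> L / sqrt (model_dim \<phi> L) \<ge> sqrt \<xi>"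
  shows "variance_sum \<ge> \<xi> * dm"
proof -
  have "sqrt \<xi> * sqrt dm \<le> sqrt n * est_error1 P X n s \<phi> L"
    using assms(2) card_pos by (simp add: model_dim_eq field_simps)
  then have "(sqrt \<xi> * sqrt dm)\<^sup>2 \<le> (sqrt n * est_error1 P X n s \<phi> L)\<^sup>2"
    using assms(1) by (intro power_mono) auto
  also have "\<dots> \<le> n * est_error2 P X n s \<phi> L"
    using est_error1_square_le n_pos by (simp add: power_mult_distrib)
  also have "\<dots> = variance_sum" using n_pos by (simp add: est_error2_eq)
  finally show ?thesis using assms(1) by (simp add: power_mult_distrib)
qed

text \<open>The vector of the centered basis functions at one point is bounded by the square root of \<open>\<phi>\<^sub>m\<close>, up to a
factor 2: this is the range in the concentration inequality for the estimation error.\<close>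

lemma L2_set_centered_le:
  "AE x in unit_lborel. L2_set (\<lambda>l. \<phi> l x - \<beta> l) L \<le> 2 * sqrt (\<Phi> * dm)"
  using phi_bound
proof eventually_elim
  case (elim x)
  have "L2_set (\<lambda>l. \<phi> l x + - \<beta> l) L \<le> L2_set (\<lambda>l. \<phi> l x) L + L2_set (\<lambda>l. - \<beta> l) L"
    by (rule L2_set_triangle_ineq)
  also have "L2_set (\<lambda>l. \<phi> l x) L \<le> sqrt (\<Phi> * dm)"
    using elim by (simp add: L2_set_def model_phi_def)
  also have "L2_set (\<lambda>l. - \<beta> l) L \<le> sqrt (\<Phi> * dm)"
    using sum_\<beta>_le by (simp add: L2_set_def)
  finally show ?case by simp
qed

lemma centered_\<phi>: "i \<in> {1..n} \<Longrightarrow> l \<in> L \<Longrightarrow> expectation (\<lambda>w. \<phi> l (X i w) - \<beta> l) = 0"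
proof -
  assume *: "i \<in> {1..n}" "l \<in> L"
  have "integrable P (\<lambda>w. \<phi> l (X i w))"
    by (rule integrable_const_bound[where B = "sqrt (\<Phi> * dm)"])
       (use AE_sample[OF \<phi>_bounded] \<phi>X_measurable * in auto)
  then show ?thesis
    using expectation_sample[OF \<phi>_measurable, of l i] * by (simp add: \<beta>_def prob_space)
qed

text \<open>The squared range \<open>4 \<Phi> D\<close> and the threshold \<open>\<delta> D\<close> are both proportional to the dimension, which
therefore cancels: all models obey the same bound.\<close>

lemma prob_chi_ge:
  fixes \<delta> :: real
  assumes "0 \<le> \<delta>"
  shows "prob {w \<in> space P. n\<^sup>2 * (\<delta> * dm) \<le> (\<Sum>l\<in>L. (S w l)\<^sup>2)} \<le> 2 * exp (- (n * \<delta> / (8 * \<Phi>)))"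
proof -
  let ?u = "n * sqrt (\<delta> * dm)"
  have "{w \<in> space P. n\<^sup>2 * (\<delta> * dm) \<le> (\<Sum>l\<in>L. (S w l)\<^sup>2)}
      = {w \<in> space P. ?u \<le> L2_set (\<lambda>l. \<Sum>i\<in>{1..n}. \<phi> l (X i w) - \<beta> l) L}"
    unfolding S_def[symmetric] L2_set_def
    using real_sqrt_le_iff[of "n\<^sup>2 * (\<delta> * dm)"] by (simp add: real_sqrt_mult)
  then have "prob {w \<in> space P. n\<^sup>2 * (\<delta> * dm) \<le> (\<Sum>l\<in>L. (S w l)\<^sup>2)}
      = prob {w \<in> space P. ?u \<le> L2_set (\<lambda>l. \<Sum>i\<in>{1..n}. \<phi> l (X i w) - \<beta> l) L}"
    by simp
  also have "\<dots> \<le> 2 * exp (- ?u\<^sup>2 / (2 * card {1..n} * (2 * sqrt (\<Phi> * dm))\<^sup>2))"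
    by (rule prob_L2_set_sum_ge[OF finite_L _ _ indep, of _ _ "\<lambda>l x. \<phi> l x - \<beta> l"])
       (use n_pos card_pos \<Phi>_pos assms AE_sample[OF L2_set_centered_le] centered_\<phi> in auto)
  also have "- ?u\<^sup>2 / (2 * card {1..n} * (2 * sqrt (\<Phi> * dm))\<^sup>2) = - (n * \<delta> / (8 * \<Phi>))"
    using n_pos card_pos[unfolded card_gt_0_iff] \<Phi>_pos assms
    by (simp add: power_mult_distrib) (simp add: field_simps power2_eq_square)
  finally show ?thesis .
qed

text \<open>The vector inequality in dimension one, with the range \<open>\<Phi> D\<close>.\<close>

lemma prob_mean_phi_ge:
  fixes t :: real
  assumes "0 \<le> t"
  shows "prob {w \<in> space P. n * t \<le> \<bar>(\<Sum>i\<in>{1..n}. model_phi \<phi> L (X i w)) - n * mean_phi\<bar>}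
    \<le> 2 * exp (- (n * t\<^sup>2 / (2 * \<Phi>\<^sup>2 * dm\<^sup>2)))"
proof -
  have bnd: "AE x in unit_lborel. \<bar>model_phi \<phi> L x - mean_phi\<bar> \<le> \<Phi> * dm"
    using phi_bound
  proof eventually_elim
    case (elim x)
    then show ?case using model_phi_nonneg[of x] mean_phi_nonneg mean_phi_le by linarith
  qed
  have cen: "expectation (\<lambda>w. model_phi \<phi> L (X i w) - mean_phi) = 0" if i: "i \<in> {1..n}" for i
  proof -
    have "integrable P (\<lambda>w. model_phi \<phi> L (X i w))"
      by (rule integrable_const_bound[where B = "\<Phi> * dm"])
         (use AE_sample[OF phi_bound i] measurable_compose[OF X_measurable[OF i] model_phi_measurable] model_phi_nonneg in auto)
    then show ?thesis
      using expectation_sample[OF model_phi_measurable i] by (simp add: mean_phi_def prob_space)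
  qed
  have "{w \<in> space P. n * t \<le> \<bar>(\<Sum>i\<in>{1..n}. model_phi \<phi> L (X i w)) - n * mean_phi\<bar>}
      = {w \<in> space P. n * t \<le> L2_set (\<lambda>_. \<Sum>i\<in>{1..n}. model_phi \<phi> L (X i w) - mean_phi) {()}}"
    by (simp add: L2_set_def sum_subtractf)
  then have "prob {w \<in> space P. n * t \<le> \<bar>(\<Sum>i\<in>{1..n}. model_phi \<phi> L (X i w)) - n * mean_phi\<bar>}
      = prob {w \<in> space P. n * t \<le> L2_set (\<lambda>_. \<Sum>i\<in>{1..n}. model_phi \<phi> L (X i w) - mean_phi) {()}}"
    by simp
  also have "\<dots> \<le> 2 * exp (- (n * t)\<^sup>2 / (2 * card {1..n} * (\<Phi> * dm)\<^sup>2))"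
    by (rule prob_L2_set_sum_ge[OF _ _ _ indep, of _ _ _ "\<lambda>_ x. model_phi \<phi> L x - mean_phi"])
       (use n_pos card_pos \<Phi>_pos assms AE_sample[OF bnd] cen in \<open>auto simp: L2_set_def\<close>)
  also have "- (n * t)\<^sup>2 / (2 * card {1..n} * (\<Phi> * dm)\<^sup>2) = - (n * t\<^sup>2 / (2 * \<Phi>\<^sup>2 * dm\<^sup>2))"
    using n_pos by (simp add: power_mult_distrib) (simp add: field_simps power2_eq_square)
  finally show ?thesis .
qed

end

section \<open>Decomposition of the leave-p-out risk\<close>

text \<open>The deterministic comparison of a model with the oracle (primed quantities). Of the gap
\<open>b / 2 + c D / k\<close> the fluctuations consume at most \<open>b / 4 + 12 \<epsilon> D / k\<close>; the factor \<open>1 + 1 / k\<close> is at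
most 2.\<close>

lemma risk_gap_positive:
  fixes b D k c \<epsilon> :: real
  assumes "k \<ge> 1" "D \<ge> 1" "b \<ge> 0" "\<epsilon> > 0" "24 * \<epsilon> \<le> c"
    and gap: "b / 2 + c * D / k \<le> b + (V - V') / k"
    and W: "\<bar>W\<bar> < \<epsilon> * D" "\<bar>W'\<bar> < \<epsilon>"
    and l: "l - l' \<le> b / 16 + \<epsilon> * D / k"
    and U: "U \<le> 2 * \<epsilon> * D / k" "- \<epsilon> / k \<le> U'"
  shows "V' / k + W' / k - (1 + 1 / k) * (2 * l' + U') < b + V / k + W / k - (1 + 1 / k) * (2 * l + U)"
proof -
  define x where "x = 1 / k"
  have x: "0 < x" "x \<le> 1" using assms(1) by (auto simp: x_def)
  have div: "a / k = a * x" for a by (simp add: x_def)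
  have Dx: "x \<le> D * x" using assms(2) x by simp
  let ?T = "2 * (l - l') + (U - U')" and ?E = "b / 8 + 5 * (\<epsilon> * (D * x))"
  have \<epsilon>D: "\<epsilon> * x \<le> \<epsilon> * (D * x)" using Dx assms(4) by (intro mult_left_mono) auto
  have "?T \<le> ?E"
    using l U \<epsilon>D unfolding div by (simp add: mult.assoc)
  moreover have E: "0 \<le> ?E" using assms(2-4) x by simp
  ultimately have "(1 + x) * ?T \<le> (1 + x) * ?E" using x by (intro mult_left_mono) auto
  also have "\<dots> \<le> 2 * ?E" using x E by (intro mult_right_mono) auto
  finally have T: "(1 + x) * ?T \<le> b / 4 + 10 * (\<epsilon> * (D * x))" by simp
  have "\<epsilon> \<le> \<epsilon> * D" using assms(2,4) by simp
  then have "W' - W < 2 * (\<epsilon> * D)" using W by linarith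
  then have "(W' - W) * x < 2 * (\<epsilon> * D) * x" using x by (intro mult_strict_right_mono)
  then have W': "(W' - W) * x < 2 * (\<epsilon> * (D * x))" by (simp add: mult.assoc)
  have "24 * \<epsilon> * (D * x) \<le> c * (D * x)" using assms(2,5) x by (intro mult_right_mono) auto
  moreover have "0 < \<epsilon> * (D * x)" using assms(2,4) x by simp
  ultimately have "(1 + x) * ?T + (W' - W) * x < b + (V - V') * x"
    using T W' gap assms(3) unfolding div by (simp add: mult.assoc)
  then show ?thesis unfolding div by (simp add: algebra_simps)
qed

context model_sample
begin

definition "phi_dev w = (\<Sum>i\<in>{1..n}. model_phi \<phi> L (X i w)) / n - mean_phi"

definition "lin_part w = (\<Sum>l\<in>L. \<beta> l * S w l) / n"

definition "quad_part w =
  ((\<Sum>l\<in>L. (S w l)\<^sup>2) - (\<Sum>i\<in>{1..n}. \<Sum>l\<in>L. (\<phi> l (X i w) - \<beta> l)\<^sup>2)) / (n * (real n - 1))"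

text \<open>Adding \<open>\<parallel>s\<parallel>\<^sup>2\<close>, the same for all models, turns the expectation into the risk for a sample of
size \<open>k\<close>.\<close>

lemma lpo_risk_decomp:
  fixes k :: real
  assumes np: "2 \<le> n" "1 \<le> p" "p \<le> n - 1" and k_def: "k = real (n - p)"
  shows "lpo_risk \<phi> L n p (\<lambda>i. X i w) + (L2_norm s)\<^sup>2
    = bias2 s \<phi> L + variance_sum / k + phi_dev w / k - (1 + 1 / k) * (2 * lin_part w + quad_part w)"
  unfolding lpo_risk_centered[OF np k_def, where c = \<beta>] bias2_eq_\<beta> variance_sum_def phi_dev_def
    lin_part_def quad_part_def S_def
  by (simp add: add_divide_distrib diff_divide_distrib algebra_simps)

lemma quad_part_le:
  assumes "2 \<le> n" "(\<Sum>l\<in>L. (S w l)\<^sup>2) \<le> n\<^sup>2 * (\<delta> * dm)" "0 \<le> \<delta>"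
  shows "quad_part w \<le> 2 * \<delta> * dm"
proof -
  have n: "real n \<ge> 2" using assms(1) by simp
  then have d: "0 < n * (real n - 1)" by simp
  have "0 \<le> (\<Sum>i\<in>{1..n}. \<Sum>l\<in>L. (\<phi> l (X i w) - \<beta> l)\<^sup>2)"
    by (intro sum_nonneg) auto
  then have "(\<Sum>l\<in>L. (S w l)\<^sup>2) - (\<Sum>i\<in>{1..n}. \<Sum>l\<in>L. (\<phi> l (X i w) - \<beta> l)\<^sup>2) \<le> n\<^sup>2 * (\<delta> * dm)"
    using assms(2) by linarith
  also have "\<dots> \<le> 2 * (n * (real n - 1)) * (\<delta> * dm)"
  proof (rule mult_right_mono)
    have "real n * 2 \<le> real n * n" using n by (intro mult_left_mono) auto
    then show "real (n\<^sup>2) \<le> 2 * (n * (real n - 1))" by (simp add: power2_eq_square algebra_simps)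
  qed (use assms(3) in auto)
  finally show ?thesis
    unfolding quad_part_def by (simp only: pos_divide_le_eq[OF d] ac_simps)
qed

text \<open>The degenerate part of the oracle enters with the favourable sign, so that it suffices to drop the
square and to bound the diagonal, without any concentration.\<close>

lemma quad_part_ge:
  assumes "2 \<le> n"
  shows "AE w in P. - (4 * \<Phi> * dm / (real n - 1)) \<le> quad_part w"
proof -
  have "AE w in P. \<forall>i\<in>{1..n}. L2_set (\<lambda>l. \<phi> l (X i w) - \<beta> l) L \<le> 2 * sqrt (\<Phi> * dm)"
    using AE_sample[OF L2_set_centered_le] by (subst AE_finite_all) auto
  then show ?thesis
  proof eventually_elim
    case (elim w)
    have "(\<Sum>l\<in>L. (\<phi> l (X i w) - \<beta> l)\<^sup>2) \<le> 4 * \<Phi> * dm" if "i \<in> {1..n}" for i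
    proof -
      have "(L2_set (\<lambda>l. \<phi> l (X i w) - \<beta> l) L)\<^sup>2 \<le> (2 * sqrt (\<Phi> * dm))\<^sup>2"
        using elim that by (intro power_mono) auto
      then show ?thesis using \<Phi>_pos
        by (simp add: L2_set_def sum_nonneg power_mult_distrib)
    qed
    then have "(\<Sum>i\<in>{1..n}. \<Sum>l\<in>L. (\<phi> l (X i w) - \<beta> l)\<^sup>2) \<le> (\<Sum>i\<in>{1..n}. 4 * \<Phi> * dm)"
      by (rule sum_mono)
    moreover have "0 \<le> (\<Sum>l\<in>L. (S w l)\<^sup>2)" by (intro sum_nonneg) auto
    ultimately have "- (n * (4 * \<Phi> * dm))
        \<le> (\<Sum>l\<in>L. (S w l)\<^sup>2) - (\<Sum>i\<in>{1..n}. \<Sum>l\<in>L. (\<phi> l (X i w) - \<beta> l)\<^sup>2)"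
      by simp
    then have "- (n * (4 * \<Phi> * dm)) / (n * (real n - 1)) \<le> quad_part w"
      unfolding quad_part_def using assms by (intro divide_right_mono) auto
    then show ?case using assms by simp
  qed
qed

lemma AE_abs_proj_le: "AE x in unit_lborel. \<bar>lin_comb \<phi> L \<beta> x\<bar> \<le> L2_norm s * sqrt (\<Phi> * dm)"
  using phi_bound
proof eventually_elim
  case (elim x)
  have "(lin_comb \<phi> L \<beta> x)\<^sup>2 \<le> (\<Sum>l\<in>L. (\<beta> l)\<^sup>2) * model_phi \<phi> L x"
    by (rule lin_comb_square_le)
  also have "\<dots> \<le> (L2_norm s)\<^sup>2 * (\<Phi> * dm)"
    using bessel[OF s_L2] elim model_phi_nonneg by (intro mult_mono) (auto simp: \<beta>_def)
  finally have "sqrt ((lin_comb \<phi> L \<beta> x)\<^sup>2) \<le> sqrt ((L2_norm s)\<^sup>2 * (\<Phi> * dm))"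
    by (rule real_sqrt_le_mono)
  moreover have "0 \<le> L2_norm s" by (simp add: L2_norm_def)
  ultimately show ?case by (simp add: real_sqrt_mult)
qed

text \<open>The summands are the centered values of \<open>s\<^sub>m - s\<close>. Their variance is at most \<open>B b\<close> because the density
is bounded by \<open>B\<close>, so a deviation of order \<open>b\<close> costs only a constant parameter in the exponential
inequality. The range is of order \<open>\<surd>D\<close>; the parameter \<open>1 / (A \<surd>D)\<close> is admissible and still gives the
exponent \<open>n \<delta> \<surd>D / A\<close>, hence at least \<open>n \<delta> / A\<close>.\<close>

lemma prob_linear_part_ge:
  fixes \<delta> A B :: real
  assumes sB: "AE x in unit_lborel. \<bar>s x\<bar> \<le> B" and "B > 0"
    and A: "2 * (L2_norm s * sqrt \<Phi> + B) \<le> A" "16 * B \<le> A" and "0 \<le> \<delta>"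
  defines "b \<equiv> bias2 s \<phi> L"
  shows "prob {w \<in> space P. n * (b / 16 + \<delta> * dm) \<le> (\<Sum>i\<in>{1..n}. lin_comb \<phi> L \<beta> (X i w) - s (X i w) + b)}
    \<le> exp (- (n * \<delta> / A))"
proof -
  let ?g = "\<lambda>x. lin_comb \<phi> L \<beta> x - s x" and ?M = "L2_norm s * sqrt (\<Phi> * dm) + B"
  have Apos: "A > 0" using A(2) \<open>B > 0\<close> by linarith
  have sd: "sqrt dm \<ge> 1" using dm_ge_1 by simp
  have gL2: "?g \<in> L2" by (intro L2_diff lin_comb_L2 s_L2)
  have g: "?g \<in> borel_measurable unit_lborel" using gL2 by (rule L2_measurable)
  have gM: "AE x in unit_lborel. \<bar>?g x\<bar> \<le> ?M"
    using AE_abs_proj_le sB by eventually_elim linarith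
  have M: "2 * ?M \<le> A * sqrt dm"
  proof -
    have "B \<le> B * sqrt dm" using \<open>B > 0\<close> sd by simp
    then have "2 * ?M \<le> 2 * (L2_norm s * sqrt \<Phi> + B) * sqrt dm"
      by (simp add: real_sqrt_mult algebra_simps)
    also have "\<dots> \<le> A * sqrt dm" using A(1) sd by (intro mult_right_mono) auto
    finally show ?thesis .
  qed
  have Eg: "L2_inner s ?g = - b"
  proof -
    have "L2_inner s ?g = L2_inner (lin_comb \<phi> L \<beta>) s - L2_inner s s"
      by (subst L2_inner_commute) (simp add: L2_inner_diff)
    also have "L2_inner (lin_comb \<phi> L \<beta>) s = L2_inner s (lin_comb \<phi> L \<beta>)"
      by (rule L2_inner_commute)
    finally show ?thesis
      unfolding b_def bias2_eq_\<beta> L2_norm_square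
      by (simp add: inner_lin_comb power2_eq_square flip: \<beta>_def)
  qed
  have b: "0 \<le> b" "b \<le> ?M"
  proof -
    show "0 \<le> b" by (simp add: b_def bias2_nonneg)
    have "L2_inner s (\<lambda>x. - ?g x) \<le> ?M"
      by (rule inner_bounded_mono[OF borel_measurable_uminus[OF g]]) (simp only: abs_minus_cancel gM)
    moreover have "L2_inner s (\<lambda>x. - ?g x) = - L2_inner s ?g"
      unfolding L2_inner_def Bochner_Integration.integral_minus[symmetric]
      by (intro Bochner_Integration.integral_cong refl) (simp add: algebra_simps)
    ultimately show "b \<le> ?M" using Eg by simp
  qed
  define a where "a = 1 / (A * sqrt dm)"
  have a: "a > 0" using Apos sd by (simp add: a_def)
  have gb: "AE x in unit_lborel. a * \<bar>?g x + b\<bar> \<le> 1"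
    using gM
  proof eventually_elim
    case (elim x)
    have "\<bar>?g x + b\<bar> \<le> \<bar>?g x\<bar> + \<bar>b\<bar>" by (rule abs_triangle_ineq)
    also have "\<dots> \<le> ?M + ?M" using elim b by (intro add_mono) (simp_all only: abs_of_nonneg)
    also have "?M + ?M = 2 * ?M" by simp
    also have "\<dots> \<le> A * sqrt dm" by (rule M)
    finally show ?case using Apos sd by (simp add: a_def divide_le_eq)
  qed
  have int_g: "integrable unit_lborel (\<lambda>x. s x * ?g x)" by (rule s_mult_integrable[OF g gM])
  have int_g2: "integrable unit_lborel (\<lambda>x. s x * (?g x)\<^sup>2)"
  proof (rule s_mult_integrable)
    show "AE x in unit_lborel. \<bar>(?g x)\<^sup>2\<bar> \<le> ?M\<^sup>2"
      using gM by eventually_elim (metis abs_ge_zero abs_power2 power2_abs power_mono)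
  qed (use g in measurable)
  have s1: "integrable unit_lborel s" "LINT x|unit_lborel. s x = 1"
    using L2_integrable[OF s_L2] inner_const[of 1] by (simp_all add: L2_inner_def)
  have cen: "L2_inner s (\<lambda>x. ?g x + b) = 0"
    using Eg int_g s1 by (simp add: L2_inner_def distrib_left)
  have var: "L2_inner s (\<lambda>x. (?g x + b)\<^sup>2) \<le> B * b"
  proof -
    have "L2_inner s (\<lambda>x. (?g x + b)\<^sup>2)
        = (LINT x|unit_lborel. s x * (?g x)\<^sup>2 + 2 * b * (s x * ?g x) + b\<^sup>2 * s x)"
      unfolding L2_inner_def by (intro Bochner_Integration.integral_cong refl)
        (simp add: power2_eq_square algebra_simps)
    also have "\<dots> = L2_inner s (\<lambda>x. (?g x)\<^sup>2) + 2 * b * L2_inner s ?g + b\<^sup>2"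
      using int_g int_g2 s1 by (simp add: L2_inner_def[of s])
    also have "\<dots> \<le> L2_inner s (\<lambda>x. (?g x)\<^sup>2)"
      unfolding Eg by (simp add: power2_eq_square)
    also have "\<dots> \<le> (LINT x|unit_lborel. B * (?g x)\<^sup>2)"
      unfolding L2_inner_def
    proof (rule integral_mono_AE[OF int_g2])
      show "integrable unit_lborel (\<lambda>x. B * (?g x)\<^sup>2)" using gL2 by (simp add: L2_def)
      show "AE x in unit_lborel. s x * (?g x)\<^sup>2 \<le> B * (?g x)\<^sup>2"
        using sB by eventually_elim (auto intro!: mult_right_mono)
    qed
    also have "\<dots> = B * L2_inner ?g ?g"
      by (simp add: L2_inner_def power2_eq_square)
    also have "L2_inner ?g ?g = b"
    proof -
      have "b = L2_inner (\<lambda>x. s x - lin_comb \<phi> L \<beta> x) (\<lambda>x. s x - lin_comb \<phi> L \<beta> x)"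
        by (simp add: b_def bias2_def L2_norm_square model_proj_eq_\<beta>)
      also have "\<dots> = L2_inner ?g ?g"
        unfolding L2_inner_def by (intro Bochner_Integration.integral_cong refl) (simp add: algebra_simps)
      finally show ?thesis ..
    qed
    finally show ?thesis .
  qed
  have gb_meas: "(\<lambda>x. ?g x + b) \<in> borel_measurable unit_lborel" using g by measurable
  have "prob {w \<in> space P. n * (b / 16 + \<delta> * dm) \<le> (\<Sum>i\<in>{1..n}. ?g (X i w) + b)}
      \<le> exp (card {1..n} * (a\<^sup>2 * (B * b)) - a * (n * (b / 16 + \<delta> * dm)))"
  proof (rule prob_sum_ge_exp[OF _ indep a gb_meas])
    fix i assume i: "i \<in> {1..n}"
    show "AE w in P. a * \<bar>?g (X i w) + b\<bar> \<le> 1" by (rule AE_sample[OF gb i])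
    show "expectation (\<lambda>w. ?g (X i w) + b) = 0"
      using expectation_sample[OF gb_meas i] by (simp add: cen)
    have "(\<lambda>x. (?g x + b)\<^sup>2) \<in> borel_measurable unit_lborel" using gb_meas by measurable
    from expectation_sample[OF this i] show "expectation (\<lambda>w. (?g (X i w) + b)\<^sup>2) \<le> B * b"
      using var by simp
  qed auto
  also have "\<dots> \<le> exp (- (n * \<delta> / A))"
  proof -
    have "a * B \<le> 1 / 16"
    proof -
      have "A * 1 \<le> A * sqrt dm" using sd Apos by (intro mult_left_mono) auto
      then have "16 * B \<le> A * sqrt dm" using A(2) by linarith
      then show ?thesis using Apos sd by (simp add: a_def field_simps)
    qed
    then have "(a * b) * (a * B) \<le> (a * b) * (1 / 16)" using a b by (intro mult_left_mono) auto
    then have 1: "n * (a\<^sup>2 * (B * b)) \<le> n * (a * (b / 16))"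
      by (intro mult_left_mono) (auto simp: power2_eq_square ac_simps)
    define r where "r = sqrt dm"
    have r: "r \<ge> 1" "dm = r * r" using sd by (simp_all add: r_def)
    have "a = 1 / (A * r)" by (simp add: a_def r_def)
    then have "a * dm = sqrt dm / A"
      unfolding r_def[symmetric] r(2) using r(1) Apos by (simp add: field_simps)
    also have "\<dots> \<ge> 1 / A" using sd Apos by (intro divide_right_mono) auto
    finally have "(n * \<delta>) * (1 / A) \<le> (n * \<delta>) * (a * dm)"
      using \<open>0 \<le> \<delta>\<close> by (intro mult_left_mono) auto
    then have 2: "n * \<delta> / A \<le> a * (n * (\<delta> * dm))" by (simp add: ac_simps)
    show ?thesis using 1 2 by (simp add: algebra_simps)
  qed
  finally show ?thesis .
qed

end

section \<open>Comparison with the oracle\<close>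

context model_sample
begin

lemma lpo_risk_measurable:
  assumes np: "2 \<le> n" "1 \<le> p" "p \<le> n - 1"
  shows "(\<lambda>w. lpo_risk \<phi> L n p (\<lambda>i. X i w)) \<in> borel_measurable P"
proof -
  have [measurable]: "(\<lambda>w. model_phi \<phi> L (X i w)) \<in> borel_measurable P" if "i \<in> {1..n}" for i
    using measurable_compose[OF X_measurable[OF that] model_phi_measurable] .
  show ?thesis
    unfolding lpo_risk_eq[OF np refl]
    by (intro borel_measurable_diff borel_measurable_divide borel_measurable_times
        borel_measurable_const borel_measurable_sum borel_measurable_power \<phi>X_measurable) measurable
qed

lemma sum_proj_minus_density:
  "(\<Sum>i\<in>{1..n}. lin_comb \<phi> L \<beta> (X i w) - f (X i w) + bias2 s \<phi> L)
    = n * lin_part w - (\<Sum>i\<in>{1..n}. f (X i w) - (L2_norm s)\<^sup>2)"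
proof -
  have "n * lin_part w = (\<Sum>l\<in>L. \<Sum>i\<in>{1..n}. \<beta> l * (\<phi> l (X i w) - \<beta> l))"
    using n_pos by (simp add: lin_part_def S_def) (simp add: sum_distrib_left)
  also have "\<dots> = (\<Sum>i\<in>{1..n}. lin_comb \<phi> L \<beta> (X i w) - (\<Sum>l\<in>L. (\<beta> l)\<^sup>2))"
    by (subst sum.swap) (simp add: lin_comb_def right_diff_distrib power2_eq_square sum_subtractf)
  finally show ?thesis
    unfolding bias2_eq_\<beta> by (simp add: sum_subtractf sum.distrib algebra_simps)
qed

text \<open>If the model contains \<open>s\<close>, then the projection is \<open>s\<close> itself. The linear part of the oracle is thus an
empirical mean of \<open>s\<close>, and the difference of two linear parts involves \<open>s\<^sub>m - s\<close> only.\<close>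

lemma lin_part_true:
  assumes "L2_mem s (model_span \<phi> L)"
  shows "AE w in P. n * lin_part w = (\<Sum>i\<in>{1..n}. s (X i w) - (L2_norm s)\<^sup>2)"
proof -
  have ae: "AE x in unit_lborel. s x = lin_comb \<phi> L \<beta> x"
    using L2_mem_span_imp_AE_eq_proj[OF s_L2 assms] by (simp add: model_proj_eq_\<beta>)
  have "AE w in P. \<forall>i\<in>{1..n}. s (X i w) = lin_comb \<phi> L \<beta> (X i w)"
    using AE_sample[OF ae] by (subst AE_finite_all) auto
  then show ?thesis
  proof eventually_elim
    case (elim w)
    have "(\<Sum>i\<in>{1..n}. lin_comb \<phi> L \<beta> (X i w) - s (X i w) + bias2 s \<phi> L) = 0"
      using elim bias2_eq_0[OF s_L2 assms] by simp
    then show ?case using sum_proj_minus_density[where f = s and w = w] n_pos by simp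
  qed
qed

text \<open>A density in a model is bounded, by Cauchy-Schwarz and the bound on \<open>\<phi>\<^sub>m\<close>.\<close>

lemma AE_density_bounded:
  assumes "L2_mem s (model_span \<phi> L)" "dm \<le> K"
  shows "AE x in unit_lborel. \<bar>s x\<bar> \<le> L2_norm s * sqrt (\<Phi> * K)"
proof -
  have ae: "AE x in unit_lborel. s x = lin_comb \<phi> L \<beta> x"
    using L2_mem_span_imp_AE_eq_proj[OF s_L2 assms(1)] by (simp add: model_proj_eq_\<beta>)
  have "L2_norm s * sqrt (\<Phi> * dm) \<le> L2_norm s * sqrt (\<Phi> * K)"
    using assms(2) \<Phi>_pos by (intro mult_left_mono) (auto simp: L2_norm_def)
  then show ?thesis
    using ae AE_abs_proj_le by (auto elim!: eventually_elim2)
qed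

text \<open>If none of four deviations occurs, \<open>risk_gap_positive\<close> applies. The four exponents are brought to the
common form \<open>\<gamma> n / k\<close>; for the two that do not depend on \<open>k\<close>, this uses \<open>k \<ge> 1\<close>.\<close>

lemma prob_lpo_risk_le:
  fixes k c \<epsilon> A B \<gamma> K :: real
  assumes bar: "model_sample P X n s \<phi> L' \<Phi>"
    and mem: "L2_mem s (model_span \<phi> L')" and K: "real (card L') \<le> K"
    and sB: "AE x in unit_lborel. \<bar>s x\<bar> \<le> B" "B > 0"
    and A: "2 * (L2_norm s * sqrt \<Phi> + B) \<le> A" "16 * B \<le> A"
    and np: "2 \<le> n" "1 \<le> p" "p \<le> n - 1" and k_def: "k = real (n - p)"
    and \<epsilon>: "\<epsilon> > 0" "24 * \<epsilon> \<le> c"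
    and gap: "bias2 s \<phi> L / 2 + c * dm / k
      \<le> bias2 s \<phi> L + (n * est_error2 P X n s \<phi> L - n * est_error2 P X n s \<phi> L') / k"
    and small: "4 * \<Phi> * K * k \<le> \<epsilon> * (real n - 1)"
    and \<gamma>: "0 < \<gamma>" "\<gamma> \<le> \<epsilon> / (8 * \<Phi>)" "\<gamma> \<le> \<epsilon>\<^sup>2 / (2 * \<Phi>\<^sup>2)" "\<gamma> \<le> \<epsilon> / A" "\<gamma> \<le> \<epsilon>\<^sup>2 / (2 * \<Phi>\<^sup>2 * K\<^sup>2)"
  shows "prob {w \<in> space P. lpo_risk \<phi> L n p (\<lambda>i. X i w) \<le> lpo_risk \<phi> L' n p (\<lambda>i. X i w)}
    \<le> 7 * exp (- (\<gamma> * n / k))"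
proof -
  interpret bar: model_sample P X n s \<phi> L' \<Phi> by (rule bar)
  have k: "k \<ge> 1" using np by (simp add: k_def)
  have n: "real n > 1" using np by simp
  have K1: "K \<ge> 1" using K bar.dm_ge_1 by linarith
  have Apos: "A > 0" using A(2) sB(2) by linarith
  define b where "b = bias2 s \<phi> L"
  define \<delta> where "\<delta> = \<epsilon> / k"
  have \<delta>: "\<delta> > 0" using \<epsilon> k by (simp add: \<delta>_def)
  let ?E1 = "{w \<in> space P. n\<^sup>2 * (\<delta> * dm) \<le> (\<Sum>l\<in>L. (S w l)\<^sup>2)}"
  let ?E2 = "{w \<in> space P. n * (\<epsilon> * dm) \<le> \<bar>(\<Sum>i\<in>{1..n}. model_phi \<phi> L (X i w)) - n * mean_phi\<bar>}"
  let ?E3 = "{w \<in> space P. n * (b / 16 + \<delta> * dm) \<le> (\<Sum>i\<in>{1..n}. lin_comb \<phi> L \<beta> (X i w) - s (X i w) + b)}"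
  let ?E4 = "{w \<in> space P. n * \<epsilon> \<le> \<bar>(\<Sum>i\<in>{1..n}. model_phi \<phi> L' (X i w)) - n * bar.mean_phi\<bar>}"
  have meas [measurable]: "(\<lambda>w. model_phi \<phi> L (X i w)) \<in> borel_measurable P"
    "(\<lambda>w. model_phi \<phi> L' (X i w)) \<in> borel_measurable P"
    "(\<lambda>w. s (X i w)) \<in> borel_measurable P"
    "(\<lambda>w. lin_comb \<phi> L \<beta> (X i w)) \<in> borel_measurable P" if "i \<in> {1..n}" for i
    using measurable_compose[OF X_measurable[OF that] model_phi_measurable]
      measurable_compose[OF X_measurable[OF that] bar.model_phi_measurable]
      measurable_compose[OF X_measurable[OF that] L2_measurable[OF s_L2]]
      measurable_compose[OF X_measurable[OF that] L2_measurable[OF lin_comb_L2]] by auto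
  have E [measurable]: "?E1 \<in> events" "?E2 \<in> events" "?E3 \<in> events" "?E4 \<in> events"
    by measurable
  have "AE w in P. w \<in> {w \<in> space P. lpo_risk \<phi> L n p (\<lambda>i. X i w) \<le> lpo_risk \<phi> L' n p (\<lambda>i. X i w)}
      \<longrightarrow> w \<in> (?E1 \<union> ?E2) \<union> (?E3 \<union> ?E4)"
    using bar.lin_part_true[OF mem] bar.quad_part_ge[OF np(1)]
  proof eventually_elim
    case (elim w)
    show ?case
    proof (intro impI, rule ccontr)
      assume w: "w \<in> {w \<in> space P. lpo_risk \<phi> L n p (\<lambda>i. X i w) \<le> lpo_risk \<phi> L' n p (\<lambda>i. X i w)}"
        and "w \<notin> (?E1 \<union> ?E2) \<union> (?E3 \<union> ?E4)"
      then have nE: "(\<Sum>l\<in>L. (S w l)\<^sup>2) < n\<^sup>2 * (\<delta> * dm)"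
        "\<bar>(\<Sum>i\<in>{1..n}. model_phi \<phi> L (X i w)) - n * mean_phi\<bar> < n * (\<epsilon> * dm)"
        "(\<Sum>i\<in>{1..n}. lin_comb \<phi> L \<beta> (X i w) - s (X i w) + b) < n * (b / 16 + \<delta> * dm)"
        "\<bar>(\<Sum>i\<in>{1..n}. model_phi \<phi> L' (X i w)) - n * bar.mean_phi\<bar> < n * \<epsilon>"
        by (auto simp: not_le)
      have dev: "\<bar>a / n - m\<bar> < t" if "\<bar>a - n * m\<bar> < n * t" for a m t :: real
      proof -
        have "a / n - m = (a - n * m) / n" using n by (simp add: field_simps)
        then show ?thesis using that n by (simp add: abs_divide divide_less_eq mult.commute)
      qed
      have "bar.variance_sum / k + bar.phi_dev w / k - (1 + 1 / k) * (2 * bar.lin_part w + bar.quad_part w)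
          < b + variance_sum / k + phi_dev w / k - (1 + 1 / k) * (2 * lin_part w + quad_part w)"
      proof (rule risk_gap_positive[OF k dm_ge_1 _ \<epsilon>])
        show "0 \<le> b" by (simp add: b_def bias2_nonneg)
        show "b / 2 + c * dm / k \<le> b + (variance_sum - bar.variance_sum) / k"
          using gap n by (simp add: b_def est_error2_eq bar.est_error2_eq)
        show "\<bar>phi_dev w\<bar> < \<epsilon> * dm" unfolding phi_dev_def by (rule dev[OF nE(2)])
        show "\<bar>bar.phi_dev w\<bar> < \<epsilon>" unfolding bar.phi_dev_def by (rule dev[OF nE(4)])
        have "n * (lin_part w - bar.lin_part w) < n * (b / 16 + \<delta> * dm)"
          using nE(3) elim(1) sum_proj_minus_density[where f = s and w = w] n by (simp add: b_def right_diff_distrib)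
        then have "lin_part w - bar.lin_part w < b / 16 + \<delta> * dm" using n by simp
        then show "lin_part w - bar.lin_part w \<le> b / 16 + \<epsilon> * dm / k" by (simp add: \<delta>_def)
        show "quad_part w \<le> 2 * \<epsilon> * dm / k"
          using quad_part_le[OF np(1), of w \<delta>] nE(1) \<delta> by (simp add: \<delta>_def)
        have "4 * \<Phi> * card L' * k \<le> 4 * \<Phi> * K * k"
          using K \<Phi>_pos k by (intro mult_right_mono mult_left_mono) auto
        with small have "4 * \<Phi> * card L' * k \<le> \<epsilon> * (real n - 1)" by linarith
        then have "4 * \<Phi> * card L' / (real n - 1) \<le> \<epsilon> / k"
          using n k by (simp add: field_simps)
        with elim(2) show "- \<epsilon> / k \<le> bar.quad_part w" by simp
      qed
      then have "lpo_risk \<phi> L' n p (\<lambda>i. X i w) < lpo_risk \<phi> L n p (\<lambda>i. X i w)"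
        using lpo_risk_decomp[OF np k_def, of w] bar.lpo_risk_decomp[OF np k_def, of w]
          bar.bias2_eq_0[OF s_L2 mem] by (simp add: b_def)
      with w show False by simp
    qed
  qed
  then have "prob {w \<in> space P. lpo_risk \<phi> L n p (\<lambda>i. X i w) \<le> lpo_risk \<phi> L' n p (\<lambda>i. X i w)}
      \<le> prob ((?E1 \<union> ?E2) \<union> (?E3 \<union> ?E4))"
    by (rule finite_measure_mono_AE) measurable
  also have "\<dots> \<le> (prob ?E1 + prob ?E2) + (prob ?E3 + prob ?E4)"
    using E by (intro order_trans[OF measure_Un_le] add_mono measure_Un_le sets.Un) auto
  also have "\<dots> \<le> (2 * exp (- (\<gamma> * n / k)) + 2 * exp (- (\<gamma> * n / k)))
      + (exp (- (\<gamma> * n / k)) + 2 * exp (- (\<gamma> * n / k)))"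
  proof (intro add_mono)
    have nk: "n / k \<ge> 0" "n / k \<le> n" using k n by (simp_all add: divide_le_eq)
    have scale: "\<gamma> * n / k \<le> n / k * a" if "\<gamma> \<le> a" for a :: real
      using mult_left_mono[OF that nk(1)] by (simp add: mult.commute)
    have scale': "\<gamma> * n / k \<le> n * a" if "\<gamma> \<le> a" for a :: real
    proof -
      have "n / k * a \<le> n * a" using nk that \<gamma>(1) by (intro mult_right_mono) auto
      with scale[OF that] show ?thesis by linarith
    qed
    have "prob ?E1 \<le> 2 * exp (- (n * \<delta> / (8 * \<Phi>)))" using \<delta> by (intro prob_chi_ge) auto
    also have "n * \<delta> / (8 * \<Phi>) = n / k * (\<epsilon> / (8 * \<Phi>))" by (simp add: \<delta>_def)
    finally show "prob ?E1 \<le> 2 * exp (- (\<gamma> * n / k))" using scale[OF \<gamma>(2)] by (smt (verit) exp_le_cancel_iff)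
    have "prob ?E2 \<le> 2 * exp (- (n * (\<epsilon> * dm)\<^sup>2 / (2 * \<Phi>\<^sup>2 * dm\<^sup>2)))"
      using \<epsilon> by (intro prob_mean_phi_ge) auto
    also have "n * (\<epsilon> * dm)\<^sup>2 / (2 * \<Phi>\<^sup>2 * dm\<^sup>2) = n * (\<epsilon>\<^sup>2 / (2 * \<Phi>\<^sup>2))"
    proof -
      define d where "d = dm"
      have "d \<noteq> 0" using card_pos[unfolded card_gt_0_iff] by (simp add: d_def)
      then show ?thesis unfolding d_def[symmetric] by (simp add: power_mult_distrib)
    qed
    finally show "prob ?E2 \<le> 2 * exp (- (\<gamma> * n / k))" using scale'[OF \<gamma>(3)] by (smt (verit) exp_le_cancel_iff)
    have "prob ?E3 \<le> exp (- (n * \<delta> / A))"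
      unfolding b_def using \<delta> by (intro prob_linear_part_ge[OF sB A]) auto
    also have "n * \<delta> / A = n / k * (\<epsilon> / A)" by (simp add: \<delta>_def)
    finally show "prob ?E3 \<le> exp (- (\<gamma> * n / k))" using scale[OF \<gamma>(4)] by (smt (verit) exp_le_cancel_iff)
    have "prob ?E4 \<le> 2 * exp (- (n * \<epsilon>\<^sup>2 / (2 * \<Phi>\<^sup>2 * (card L')\<^sup>2)))"
      using \<epsilon> bar.prob_mean_phi_ge[of \<epsilon>] by simp
    moreover have "\<gamma> * n / k \<le> n * \<epsilon>\<^sup>2 / (2 * \<Phi>\<^sup>2 * (card L')\<^sup>2)"
    proof -
      have "(card L')\<^sup>2 \<le> K\<^sup>2" using K by (simp add: power_mono)
      then have "\<epsilon>\<^sup>2 / (2 * \<Phi>\<^sup>2 * K\<^sup>2) \<le> \<epsilon>\<^sup>2 / (2 * \<Phi>\<^sup>2 * (card L')\<^sup>2)"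
        using \<Phi>_pos bar.card_pos K1 by (intro divide_left_mono mult_left_mono mult_pos_pos) auto
      with scale'[of "\<epsilon>\<^sup>2 / (2 * \<Phi>\<^sup>2 * (card L')\<^sup>2)"] \<gamma>(5) show ?thesis by simp
    qed
    ultimately show "prob ?E4 \<le> 2 * exp (- (\<gamma> * n / k))" by (smt (verit) exp_le_cancel_iff)
  qed
  finally show ?thesis by simp
qed

end

text \<open>A union bound: if the minimiser is not \<open>m\<close>, then some other index does at least as well.\<close>

lemma (in prob_space) prob_argmin_ge:
  fixes R :: "'m \<Rightarrow> 'a \<Rightarrow> real" and r :: real
  assumes "finite I" "m \<in> I" and h: "h \<in> measurable M (count_space I)"
    and R: "\<And>i. i \<in> I \<Longrightarrow> R i \<in> borel_measurable M"
    and min: "\<And>w. w \<in> space M \<Longrightarrow> is_arg_min (\<lambda>i. R i w) (\<lambda>i. i \<in> I) (h w)"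
    and r: "\<And>i. i \<in> I - {m} \<Longrightarrow> prob {w \<in> space M. R i w \<le> R m w} \<le> r" and "0 \<le> r"
  shows "1 - card I * r \<le> prob {w \<in> space M. h w = m}"
proof -
  have ev: "{w \<in> space M. R i w \<le> R m w} \<in> events" if "i \<in> I" for i
    using R[OF that] R[OF assms(2)] by measurable
  have hm: "{w \<in> space M. h w = m} \<in> events"
    using measurable_sets[OF h, of "{m}"] assms(2) by (simp add: vimage_def Int_def conj_commute)
  have "{w \<in> space M. \<not> h w = m} \<subseteq> (\<Union>i\<in>I - {m}. {w \<in> space M. R i w \<le> R m w})"
  proof safe
    fix w assume w: "w \<in> space M" "h w \<noteq> m"
    have "h w \<in> I" "\<not> R m w < R (h w) w"
      using min[OF w(1)] assms(2) by (auto simp: is_arg_min_def)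
    with w show "w \<in> (\<Union>i\<in>I - {m}. {w \<in> space M. R i w \<le> R m w})"
      by (auto intro!: bexI[of _ "h w"])
  qed
  then have "prob {w \<in> space M. \<not> h w = m} \<le> prob (\<Union>i\<in>I - {m}. {w \<in> space M. R i w \<le> R m w})"
    using ev assms(1) by (intro finite_measure_mono) auto
  also have "\<dots> \<le> (\<Sum>i\<in>I - {m}. prob {w \<in> space M. R i w \<le> R m w})"
    using ev assms(1) by (intro measure_UNION_le) auto
  also have "\<dots> \<le> (\<Sum>i\<in>I - {m}. r)" by (intro sum_mono r)
  also have "\<dots> \<le> card I * r"
    using assms(1) \<open>0 \<le> r\<close> by (simp add: mult_right_mono card_mono)
  finally have "prob {w \<in> space M. \<not> h w = m} \<le> card I * r" .
  with prob_neg[of "\<lambda>w. h w = m"] hm show ?thesis by simp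
qed

text \<open>The constant \<open>c\<close> serves three types of competitors: nonparametric ones, where \<open>V\<close> is at least twice that
of the oracle; parametric ones without bias, where \<open>V\<close> exceeds that of the oracle by the factor \<open>1 + \<mu>\<close>;
and parametric ones with a bias at least \<open>\<tau>\<close>, whose dimension is at most \<open>\<pi>\<^sub>0 / \<xi>\<close>.\<close>

lemma oracle_gap:
  fixes b V D :: "'m \<Rightarrow> real" and n k c \<xi> \<mu> \<pi>\<^sub>0 \<tau> :: real
  assumes pos: "0 < n" "0 < k" "0 < \<xi>" "0 < \<mu>" "0 < \<pi>\<^sub>0" "0 < \<tau>"
    and M: "\<And>m. m \<in> MP \<union> MN \<Longrightarrow> 0 \<le> b m \<and> 0 \<le> D m \<and> \<xi> * D m \<le> V m"
    and MP: "\<And>m. m \<in> MP \<Longrightarrow> V m \<le> \<pi>\<^sub>0 \<and> (b m = 0 \<or> \<tau> \<le> b m)"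
    and MN: "\<And>m. m \<in> MN \<Longrightarrow> 2 * \<pi>\<^sub>0 \<le> V m"
    and m\<^sub>0: "m\<^sub>0 \<in> MP" "b m\<^sub>0 = 0"
    and bar: "mbar \<in> MP \<union> MN" "b mbar + V mbar / n \<le> b m\<^sub>0 + V m\<^sub>0 / n"
    and BeMo: "\<And>m. m \<in> MP \<union> MN - {mbar} \<Longrightarrow> (1 + \<mu>) * (b mbar + V mbar / n) \<le> b m + V m / n"
    and n_large: "\<pi>\<^sub>0 < \<tau> * n"
    and k_large: "2 * (\<pi>\<^sub>0 + c * (\<pi>\<^sub>0 / \<xi>)) \<le> \<tau> * k"
    and c: "0 < c" "c \<le> \<xi> / 2" "c \<le> \<mu> / (1 + \<mu>) * \<xi>"
  shows "mbar \<in> MP" "b mbar = 0" "V mbar \<le> \<pi>\<^sub>0"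
    and "\<And>m. m \<in> MP \<union> MN - {mbar} \<Longrightarrow> b m / 2 + c * D m / k \<le> b m + (V m - V mbar) / k"
proof -
  have "b mbar + V mbar / n \<le> \<pi>\<^sub>0 / n"
    using bar(2) MP[OF m\<^sub>0(1)] m\<^sub>0(2) pos divide_right_mono[of "V m\<^sub>0" \<pi>\<^sub>0 n] by simp
  from pos_le_divide_eq[OF pos(1), THEN iffD1, OF this]
  have le: "b mbar * n + V mbar \<le> \<pi>\<^sub>0" using pos by (simp add: distrib_right)
  have nn: "0 \<le> b mbar" "0 \<le> V mbar"
  proof -
    show "0 \<le> b mbar" using M[OF bar(1)] by simp
    have "0 \<le> \<xi> * D mbar" using M[OF bar(1)] pos by simp
    with M[OF bar(1)] show "0 \<le> V mbar" by linarith
  qed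
  have "0 \<le> b mbar * n" using nn pos by simp
  with le show V: "V mbar \<le> \<pi>\<^sub>0" by linarith
  show mP: "mbar \<in> MP" using bar(1) MN[of mbar] V pos by auto
  show b0: "b mbar = 0"
  proof (rule ccontr)
    assume "b mbar \<noteq> 0"
    then have "\<tau> * n \<le> b mbar * n" using MP[OF mP] pos by (intro mult_right_mono) auto
    with le nn n_large show False by linarith
  qed
  fix m assume m: "m \<in> MP \<union> MN - {mbar}"
  then have m': "0 \<le> b m" "0 \<le> D m" "\<xi> * D m \<le> V m" using M by auto
  have cD: "c * D m \<le> \<xi> * D m / 2" using c(2) m' mult_right_mono[of c "\<xi> / 2" "D m"] by simp
  consider "m \<in> MN" | "m \<in> MP" "b m = 0" | "m \<in> MP" "\<tau> \<le> b m" using m MP by auto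
  then show "b m / 2 + c * D m / k \<le> b m + (V m - V mbar) / k"
  proof cases
    case 1
    then have "c * D m \<le> V m - V mbar" using MN[of m] V cD m' by linarith
    then have "c * D m / k \<le> (V m - V mbar) / k" using pos by (intro divide_right_mono) auto
    then show ?thesis using m' by linarith
  next
    case 2
    have "(1 + \<mu>) * (V mbar / n) \<le> V m / n" using BeMo[OF m] b0 2 by simp
    then have bm: "(1 + \<mu>) * V mbar \<le> V m"
      using mult_right_mono[of _ _ n] pos by fastforce
    have "c * D m \<le> \<mu> / (1 + \<mu>) * (\<xi> * D m)"
      using mult_right_mono[OF c(3) m'(2)] by simp
    also have "\<dots> \<le> \<mu> / (1 + \<mu>) * V m" using m' pos by (intro mult_left_mono) auto
    also have "\<dots> \<le> V m - V mbar"
      using bm pos by (simp add: field_simps)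
    finally have "c * D m / k \<le> (V m - V mbar) / k" using pos by (intro divide_right_mono) auto
    then show ?thesis using 2 by simp
  next
    case 3
    have "D m \<le> \<pi>\<^sub>0 / \<xi>" using MP[OF 3(1)] m' pos by (simp add: field_simps)
    then have "c * D m \<le> c * (\<pi>\<^sub>0 / \<xi>)" using c by (intro mult_left_mono) auto
    moreover have "0 \<le> V m" using m' pos mult_nonneg_nonneg[of \<xi> "D m"] by linarith
    moreover have "\<tau> * k \<le> b m * k" using 3 pos by (intro mult_right_mono) auto
    moreover have "b m / 2 * k = b m * k / 2" by simp
    moreover have "2 * \<pi>\<^sub>0 + 2 * (c * (\<pi>\<^sub>0 / \<xi>)) \<le> \<tau> * k" using k_large by (simp only: distrib_left)
    ultimately have "c * D m \<le> b m / 2 * k + (V m - V mbar)" using V by argo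
    then have "c * D m / k \<le> (b m / 2 * k + (V m - V mbar)) / k"
      using pos by (intro divide_right_mono) auto
    also have "\<dots> = b m / 2 + (V m - V mbar) / k" using pos by (simp add: add_divide_distrib)
    finally show ?thesis by linarith
  qed
qed

section \<open>Consistency of the selection\<close>

theorem theorem3p3:
  fixes P :: "nat \<Rightarrow> 'w measure"
    and X :: "nat \<Rightarrow> nat \<Rightarrow> 'w \<Rightarrow> real"
    and s :: "real \<Rightarrow> real"
    and \<M> \<M>P \<M>NP :: "nat \<Rightarrow> 'm set"
    and \<Lambda> :: "'m \<Rightarrow> 'l set"
    and \<phi> :: "'l \<Rightarrow> real \<Rightarrow> real"
    and mbar :: "nat \<Rightarrow> 'm"
    and mhat :: "nat \<Rightarrow> nat \<Rightarrow> 'w \<Rightarrow> 'm"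
    and p :: "nat \<Rightarrow> nat"
    and a\<^sub>M \<Phi> \<xi> \<mu> \<pi>\<^sub>0 \<tau> :: real
    and n\<^sub>0 :: nat
  assumes prob: "\<forall>n\<ge>1. prob_space (P n)"
    and indep: "\<forall>n\<ge>1. prob_space.indep_vars (P n) (\<lambda>_. unit_lborel) (X n) {1..n}"
    and density: "\<forall>n\<ge>1. \<forall>i\<in>{1..n}. distributed (P n) unit_lborel (X n i) (\<lambda>x. ennreal (s x))"
    and s_nonneg: "\<forall>x\<in>{0..1}. 0 \<le> s x"
    and SqI: "s \<in> L2"
    and models: "\<forall>n\<ge>1. \<forall>m\<in>\<M> n. finite (\<Lambda> m) \<and> orthonormal_family \<phi> (\<Lambda> m)"
    and Pol: "a\<^sub>M \<ge> 0" "\<forall>n\<ge>1. finite (\<M> n) \<and> real (card (\<M> n)) \<le> real n powr a\<^sub>M"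
    and RegD: "\<Phi> > 0"
      "\<forall>n\<ge>1. \<forall>m\<in>\<M> n.
         Linf_norm (model_phi \<phi> (\<Lambda> m)) / ereal (real (model_dim \<phi> (\<Lambda> m))) \<le> ereal \<Phi>"
    and Dmax: \<comment> \<open>for \<open>n = 1\<close> the bound is infinite\<close>
      "\<forall>n\<ge>2. \<forall>m\<in>\<M> n. real (model_dim \<phi> (\<Lambda> m)) \<le> real n / (ln (real n))\<^sup>2"
    and LoEx: "\<xi> > 0"
      "\<forall>n\<ge>1. \<forall>m\<in>\<M> n.
         sqrt (real n) * est_error1 (P n) (X n) n s \<phi> (\<Lambda> m)
           / sqrt (real (model_dim \<phi> (\<Lambda> m))) \<ge> sqrt \<xi>"
    and PNP: "\<forall>n\<ge>1. \<M> n = \<M>P n \<union> \<M>NP n"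
    and PNP_param: "\<pi>\<^sub>0 > 0" "\<tau> > 0"
      "\<forall>n\<ge>1. \<forall>m\<in>\<M>P n. real n * est_error2 (P n) (X n) n s \<phi> (\<Lambda> m) \<le> \<pi>\<^sub>0"
      "\<forall>n\<ge>1. \<forall>m\<in>\<M>P n. \<not> L2_mem s (model_span \<phi> (\<Lambda> m)) \<longrightarrow> bias2 s \<phi> (\<Lambda> m) \<ge> \<tau>"
    and PNP_nonparam: \<comment> \<open>extended reals, as the infimum over an empty set is infinite\<close>
      "(\<lambda>n. ereal (real n / (ln (real n))\<^sup>2)
              * (INF m\<in>\<M>NP n. ereal (est_error2 (P n) (X n) n s \<phi> (\<Lambda> m))))
         \<longlonglongrightarrow> \<infinity>"
    and mbar: "\<forall>n\<ge>1. is_arg_min (\<lambda>m. quad_risk (P n) (X n) n s \<phi> (\<Lambda> m)) (\<lambda>m. m \<in> \<M> n) (mbar n)"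
    and BeMo: "\<mu> > 0" "n\<^sub>0 \<ge> 1"
      "\<forall>n>n\<^sub>0. \<forall>m\<in>\<M> n - {mbar n}.
         (1 + \<mu>) * quad_risk (P n) (X n) n s \<phi> (\<Lambda> (mbar n)) \<le> quad_risk (P n) (X n) n s \<phi> (\<Lambda> m)"
    and mhat_measurable: "\<forall>n\<ge>2. \<forall>q\<in>{1..n-1}. mhat n q \<in> measurable (P n) (count_space (\<M> n))"
    and mhat: "\<forall>n\<ge>2. \<forall>q\<in>{1..n-1}. \<forall>w\<in>space (P n).
         is_arg_min (\<lambda>m. lpo_risk \<phi> (\<Lambda> m) n q (\<lambda>i. X n i w)) (\<lambda>m. m \<in> \<M> n) (mhat n q w)"
    and true_model: \<comment> \<open>\<open>s\<close> belongs to a model of the collection, of parametric type\<close>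
      "\<forall>\<^sub>F n in sequentially. \<exists>m\<in>\<M>P n. L2_mem s (model_span \<phi> (\<Lambda> m))"
    and p_range: "\<forall>n\<ge>2. 1 \<le> p n \<and> p n \<le> n - 1"
    and p_log: "(\<lambda>n. ln (real n) * (1 - real (p n) / real n)) \<longlonglongrightarrow> 0"
    and p_lin: "filterlim (\<lambda>n. real n * (1 - real (p n) / real n)) at_top sequentially"
  shows "(\<lambda>n. measure (P n) {w \<in> space (P n). mhat n (p n) w = mbar n}) \<longlonglongrightarrow> 1"
proof -
  have sample: "model_sample (P n) (X n) n s \<phi> (\<Lambda> m) \<Phi>" if n: "1 \<le> n" and m: "m \<in> \<M> n" for n m
  proof -
    interpret prob_space "P n" using prob n by blast
    interpret orthonormal \<phi> "\<Lambda> m" using models n m by unfold_locales auto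
    have "card (\<Lambda> m) > 0"
    proof (rule ccontr)
      assume "\<not> card (\<Lambda> m) > 0"
      then have "model_dim \<phi> (\<Lambda> m) = 0" by (simp only: model_dim_eq not_gr_zero)
      moreover have "sqrt (real n) * est_error1 (P n) (X n) n s \<phi> (\<Lambda> m)
          / sqrt (real (model_dim \<phi> (\<Lambda> m))) \<ge> sqrt \<xi>"
        using LoEx(2) n m by blast
      ultimately show False using LoEx(1) by simp
    qed
    moreover from this have "AE x in unit_lborel. model_phi \<phi> (\<Lambda> m) x \<le> \<Phi> * card (\<Lambda> m)"
      using RegD(2) n m by (intro model_phi_bound) auto
    ultimately show ?thesis
      using n indep density s_nonneg SqI RegD(1) by unfold_locales auto
  qed
  define V where "V n m = n * est_error2 (P n) (X n) n s \<phi> (\<Lambda> m)" for n m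
  define b where "b m = bias2 s \<phi> (\<Lambda> m)" for m
  define D where "D m = real (card (\<Lambda> m))" for m
  have model: "0 \<le> b m" "1 \<le> D m" "\<xi> * D m \<le> V n m"
      "quad_risk (P n) (X n) n s \<phi> (\<Lambda> m) = b m + V n m / n"
      "L2_mem s (model_span \<phi> (\<Lambda> m)) \<Longrightarrow> b m = 0"
    if n: "1 \<le> n" and m: "m \<in> \<M> n" for n m
  proof -
    interpret model_sample "P n" "X n" n s \<phi> "\<Lambda> m" \<Phi> by (rule sample[OF n m])
    have V: "V n m = variance_sum" using n by (simp add: V_def est_error2_eq)
    show "0 \<le> b m" by (simp add: b_def bias2_nonneg)
    show "1 \<le> D m" unfolding D_def by (rule dm_ge_1)
    show "\<xi> * D m \<le> V n m"
      unfolding V D_def using LoEx n m by (intro variance_sum_ge) auto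
    show "quad_risk (P n) (X n) n s \<phi> (\<Lambda> m) = b m + V n m / n"
      by (simp add: quad_risk_eq V b_def)
    show "b m = 0" if "L2_mem s (model_span \<phi> (\<Lambda> m))"
      unfolding b_def by (rule bias2_eq_0[OF s_L2 that])
  qed

  define c where "c = min (\<xi> / 2) (\<mu> / (1 + \<mu>) * \<xi>)"
  define \<epsilon> where "\<epsilon> = c / 24"
  \<comment> \<open>\<open>K\<close> bounds the dimension of the oracle and \<open>B\<close> the density; \<open>A\<close> and \<open>\<gamma>\<close> are as required by
    \<open>prob_lpo_risk_le\<close>.\<close>
  define K where "K = \<pi>\<^sub>0 / \<xi>"
  define B where "B = L2_norm s * sqrt (\<Phi> * K) + 1"
  define A where "A = 2 * (L2_norm s * sqrt \<Phi>) + 18 * B"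
  define \<gamma> where "\<gamma> = Min {\<epsilon> / (8 * \<Phi>), \<epsilon>\<^sup>2 / (2 * \<Phi>\<^sup>2), \<epsilon> / A, \<epsilon>\<^sup>2 / (2 * \<Phi>\<^sup>2 * K\<^sup>2)}"
  have c: "c > 0" "c \<le> \<xi> / 2" "c \<le> \<mu> / (1 + \<mu>) * \<xi>" "\<epsilon> > 0" "24 * \<epsilon> \<le> c"
  proof -
    show "c > 0" using LoEx(1) BeMo(1) by (simp add: c_def)
    then show "\<epsilon> > 0" "24 * \<epsilon> \<le> c" by (simp_all add: \<epsilon>_def)
    show "c \<le> \<xi> / 2" "c \<le> \<mu> / (1 + \<mu>) * \<xi>"
      unfolding c_def by (rule min.cobounded1, rule min.cobounded2)
  qed
  have K: "K > 0" using PNP_param(1) LoEx(1) by (simp add: K_def)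
  have norm0: "0 \<le> L2_norm s" by (simp add: L2_norm_def)
  have B: "B > 0" using norm0 K RegD(1) by (simp add: B_def add_nonneg_pos)
  have A: "2 * (L2_norm s * sqrt \<Phi> + B) \<le> A" "16 * B \<le> A" "A > 0"
  proof -
    have "0 \<le> L2_norm s * sqrt \<Phi>" using norm0 RegD(1) by simp
    then show "2 * (L2_norm s * sqrt \<Phi> + B) \<le> A" "16 * B \<le> A" "A > 0"
      using B by (auto simp: A_def)
  qed
  have \<gamma>: "\<gamma> > 0" "\<gamma> \<le> \<epsilon> / (8 * \<Phi>)" "\<gamma> \<le> \<epsilon>\<^sup>2 / (2 * \<Phi>\<^sup>2)" "\<gamma> \<le> \<epsilon> / A"
      "\<gamma> \<le> \<epsilon>\<^sup>2 / (2 * \<Phi>\<^sup>2 * K\<^sup>2)"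
  proof -
    show "\<gamma> > 0" using c(4) RegD(1) A(3) K by (simp add: \<gamma>_def)
  qed (unfold \<gamma>_def, (rule Min_le, simp, blast)+)

  define k where "k n = real (n - p n)" for n
  have k_eq: "real n * (1 - real (p n) / real n) = k n" "1 - real (p n) / real n = k n / n" if "n \<ge> 2" for n
  proof -
    have "p n \<le> n - 1" using p_range that by blast
    then have "p n \<le> n" by linarith
    then have eq: "k n = real n - real (p n)" by (simp add: k_def of_nat_diff)
    show "real n * (1 - real (p n) / real n) = k n" "1 - real (p n) / real n = k n / n"
      unfolding eq using that by (simp_all add: right_diff_distrib diff_divide_distrib)
  qed
  \<comment> \<open>The bound on \<open>log(n) k / n\<close> is used twice: the first entry makes \<open>\<gamma> n / k\<close> exceed
    \<open>(a\<^sub>M + 1) log n\<close>, the second one makes the degenerate part of the oracle negligible.\<close>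
  define \<rho> where "\<rho> = min (\<gamma> / (a\<^sub>M + 1)) (\<epsilon> / (8 * \<Phi> * K))"
  have \<rho>: "\<rho> > 0" "\<rho> \<le> \<gamma> / (a\<^sub>M + 1)" "\<rho> \<le> \<epsilon> / (8 * \<Phi> * K)"
  proof -
    show "\<rho> > 0" using \<gamma>(1) Pol(1) c(4) RegD(1) K by (simp add: \<rho>_def)
  qed (simp_all only: \<rho>_def min.cobounded1 min.cobounded2)
  have ev_log: "\<forall>\<^sub>F n in sequentially. ln (real n) * (1 - real (p n) / real n) < \<rho>"
    using order_tendstoD(2)[OF p_log \<rho>(1)] .
  have ev_k: "\<forall>\<^sub>F n in sequentially. 2 * (\<pi>\<^sub>0 + c * (\<pi>\<^sub>0 / \<xi>)) / \<tau> \<le> real n * (1 - real (p n) / real n)"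
    using p_lin by (simp only: filterlim_at_top)
  have ev_n: "\<forall>\<^sub>F n in sequentially. \<pi>\<^sub>0 / \<tau> < real n"
    using filterlim_real_sequentially by (simp add: filterlim_at_top_dense)
  have ev_NP: "\<forall>\<^sub>F n in sequentially. ereal (2 * \<pi>\<^sub>0) < ereal (real n / (ln (real n))\<^sup>2)
              * (INF m\<in>\<M>NP n. ereal (est_error2 (P n) (X n) n s \<phi> (\<Lambda> m)))"
    by (rule order_tendstoD(1)[OF PNP_nonparam]) simp

  have lower: "\<forall>\<^sub>F n in sequentially. 1 - 7 / real n \<le> measure (P n) {w \<in> space (P n). mhat n (p n) w = mbar n}"
    using ev_log ev_k ev_n ev_NP true_model eventually_ge_at_top[of 3] eventually_gt_at_top[of n\<^sub>0]
  proof eventually_elim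
    case (elim n)
    interpret prob_space "P n" using prob elim(6) by simp
    have n1: "1 \<le> n" "2 \<le> n" "real n > 0" using elim(6) by auto
    have ln1: "1 \<le> ln (real n)"
    proof -
      have "exp 1 \<le> real n" using exp_le elim(6) by linarith
      then show ?thesis using n1 by (simp add: ln_ge_iff)
    qed
    have p: "1 \<le> p n" "p n \<le> n - 1" using p_range n1 by auto
    have "1 \<le> n - p n" using p n1 by linarith
    then have k1: "1 \<le> k n" by (simp add: k_def)
    have k_log: "ln (real n) * (k n / n) < \<rho>" using elim(1) k_eq[OF n1(2)] by simp
    have Mn: "\<M> n = \<M>P n \<union> \<M>NP n" using PNP n1 by blast
    obtain m\<^sub>0 where m\<^sub>0: "m\<^sub>0 \<in> \<M>P n" "L2_mem s (model_span \<phi> (\<Lambda> m\<^sub>0))" using elim(5) by blast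
    have arg: "mbar n \<in> \<M> n" "\<And>m. m \<in> \<M> n \<Longrightarrow>
        quad_risk (P n) (X n) n s \<phi> (\<Lambda> (mbar n)) \<le> quad_risk (P n) (X n) n s \<phi> (\<Lambda> m)"
      using mbar n1 by (auto simp: is_arg_min_linorder)
    have NP: "2 * \<pi>\<^sub>0 \<le> V n m" if m: "m \<in> \<M>NP n" for m
    proof -
      let ?e = "est_error2 (P n) (X n) n s \<phi> (\<Lambda> m)"
      have e0: "0 \<le> ?e" by (simp add: est_error2_def)
      have "ereal (2 * \<pi>\<^sub>0) \<le> ereal (real n / (ln (real n))\<^sup>2)
          * (INF m\<in>\<M>NP n. ereal (est_error2 (P n) (X n) n s \<phi> (\<Lambda> m)))"
        using elim(4) by (rule less_imp_le)
      also have "\<dots> \<le> ereal (real n / (ln (real n))\<^sup>2) * ereal ?e"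
        using m by (intro ereal_mult_left_mono INF_lower) auto
      finally have "2 * \<pi>\<^sub>0 \<le> real n / (ln (real n))\<^sup>2 * ?e" by simp
      also have "\<dots> \<le> real n * ?e"
      proof (rule mult_right_mono[OF _ e0])
        \<comment> \<open>\<open>n \<ge> 3\<close> makes the logarithm at least 1.\<close>
        have "1 \<le> (ln (real n))\<^sup>2" using ln1 by (simp add: one_le_power)
        then show "real n / (ln (real n))\<^sup>2 \<le> real n" using n1(3) by (simp add: divide_le_eq)
      qed
      finally show ?thesis by (simp add: V_def)
    qed
    have gap: "mbar n \<in> \<M>P n" "b (mbar n) = 0" "V n (mbar n) \<le> \<pi>\<^sub>0"
      "\<And>m. m \<in> \<M>P n \<union> \<M>NP n - {mbar n} \<Longrightarrow>
        b m / 2 + c * D m / k n \<le> b m + (V n m - V n (mbar n)) / k n"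
    proof (atomize (full), intro conjI allI impI)
      note * = oracle_gap[where MP = "\<M>P n" and MN = "\<M>NP n" and b = b and V = "V n" and D = D
          and n = "real n" and k = "k n" and c = c and \<xi> = \<xi> and \<mu> = \<mu> and \<pi>\<^sub>0 = \<pi>\<^sub>0
          and \<tau> = \<tau> and mbar = "mbar n" and m\<^sub>0 = m\<^sub>0]
      have prems: "0 < real n" "0 < k n" "0 < \<xi>" "0 < \<mu>" "0 < \<pi>\<^sub>0" "0 < \<tau>"
        using n1 k1 LoEx(1) BeMo(1) PNP_param by auto
      have M: "0 \<le> b m \<and> 0 \<le> D m \<and> \<xi> * D m \<le> V n m" if "m \<in> \<M>P n \<union> \<M>NP n" for m
        using model[OF n1(1), of m] that Mn by auto
      have MP: "V n m \<le> \<pi>\<^sub>0 \<and> (b m = 0 \<or> \<tau> \<le> b m)" if "m \<in> \<M>P n" for m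
        using PNP_param(3,4) model(5)[OF n1(1), of m] that n1(1) Mn unfolding V_def b_def by blast
      have b0: "b m\<^sub>0 = 0" using model(5)[OF n1(1), of m\<^sub>0] m\<^sub>0 Mn by auto
      have bar: "mbar n \<in> \<M>P n \<union> \<M>NP n" using arg(1) Mn by simp
      have risk: "b (mbar n) + V n (mbar n) / real n \<le> b m\<^sub>0 + V n m\<^sub>0 / real n"
        using arg(2)[of m\<^sub>0] m\<^sub>0(1) Mn model(4)[OF n1(1)] arg(1) by auto
      have Be: "(1 + \<mu>) * (b (mbar n) + V n (mbar n) / real n) \<le> b m + V n m / real n"
        if "m \<in> \<M>P n \<union> \<M>NP n - {mbar n}" for m
      proof -
        have "(1 + \<mu>) * quad_risk (P n) (X n) n s \<phi> (\<Lambda> (mbar n)) \<le> quad_risk (P n) (X n) n s \<phi> (\<Lambda> m)"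
          using BeMo(3) elim(7) that Mn by auto
        then show ?thesis using that Mn model(4)[OF n1(1)] arg(1) by auto
      qed
      have nl: "\<pi>\<^sub>0 < \<tau> * real n"
        using elim(3) PNP_param(2) by (simp add: pos_divide_less_eq mult.commute)
      have kl: "2 * (\<pi>\<^sub>0 + c * (\<pi>\<^sub>0 / \<xi>)) \<le> \<tau> * k n"
        using elim(2) PNP_param(2) unfolding k_eq(1)[OF n1(2)] by (simp only: pos_divide_le_eq mult.commute)
      note ** = *[OF prems M MP NP m\<^sub>0(1) b0 bar risk Be nl kl c(1-3)]
      show "mbar n \<in> \<M>P n" by (rule **(1))
      show "b (mbar n) = 0" by (rule **(2))
      show "V n (mbar n) \<le> \<pi>\<^sub>0" by (rule **(3))
      show "b m / 2 + c * D m / k n \<le> b m + (V n m - V n (mbar n)) / k n"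
        if "m \<in> \<M>P n \<union> \<M>NP n - {mbar n}" for m by (rule **(4)) (use that in simp_all)
    qed
    interpret bar: model_sample "P n" "X n" n s \<phi> "\<Lambda> (mbar n)" \<Phi> by (rule sample[OF n1(1) arg(1)])
    have mem: "L2_mem s (model_span \<phi> (\<Lambda> (mbar n)))"
    proof (rule ccontr)
      assume "\<not> L2_mem s (model_span \<phi> (\<Lambda> (mbar n)))"
      then have "\<tau> \<le> b (mbar n)" using PNP_param(4) n1(1) gap(1) unfolding b_def by blast
      with gap(2) PNP_param(2) show False by simp
    qed
    have DK: "real (card (\<Lambda> (mbar n))) \<le> K"
      using model(3)[OF n1(1) arg(1)] gap(3) LoEx(1)
      by (simp add: K_def D_def pos_le_divide_eq mult.commute)
    have sB: "AE x in unit_lborel. \<bar>s x\<bar> \<le> B"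
      using bar.AE_density_bounded[OF mem DK] by eventually_elim (simp add: B_def)
    have small: "4 * \<Phi> * K * k n \<le> \<epsilon> * (real n - 1)"
    proof -
      have "k n / n \<le> ln (real n) * (k n / n)"
        using ln1 k1 n1 mult_right_mono[of 1 "ln (real n)" "k n / n"] by simp
      then have "k n / n \<le> \<epsilon> / (8 * \<Phi> * K)" using k_log \<rho>(3) by linarith
      then have "8 * \<Phi> * K * k n \<le> \<epsilon> * n" using n1(3) RegD(1) K by (simp add: field_simps)
      moreover have "\<epsilon> * n \<le> \<epsilon> * (2 * (real n - 1))" using c(4) n1(2) by (intro mult_left_mono) auto
      moreover have "\<epsilon> * (2 * (real n - 1)) = 2 * (\<epsilon> * (real n - 1))" by simp
      ultimately show ?thesis by linarith
    qed
    have rate: "(a\<^sub>M + 1) * ln (real n) \<le> \<gamma> * n / k n"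
    proof -
      have "ln (real n) * (k n / n) \<le> \<gamma> / (a\<^sub>M + 1)" using k_log \<rho>(2) by linarith
      then show ?thesis using n1(3) k1 Pol(1) by (simp add: field_simps)
    qed
    let ?R = "\<lambda>m w. lpo_risk \<phi> (\<Lambda> m) n (p n) (\<lambda>i. X n i w)"
    have "prob {w \<in> space (P n). ?R m w \<le> ?R (mbar n) w} \<le> 7 * exp (- (\<gamma> * n / k n))"
      if m: "m \<in> \<M> n - {mbar n}" for m
    proof -
      interpret model_sample "P n" "X n" n s \<phi> "\<Lambda> m" \<Phi> using sample[OF n1(1)] m by blast
      have g: "bias2 s \<phi> (\<Lambda> m) / 2 + c * real (card (\<Lambda> m)) / k n \<le> bias2 s \<phi> (\<Lambda> m)
          + (n * est_error2 (P n) (X n) n s \<phi> (\<Lambda> m) - n * est_error2 (P n) (X n) n s \<phi> (\<Lambda> (mbar n))) / k n"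
        using gap(4)[of m] m Mn by (simp add: b_def D_def V_def)
      show ?thesis
        by (rule prob_lpo_risk_le[OF sample[OF n1(1) arg(1)] mem DK sB B A(1,2) n1(2) p k_def
              c(4,5) g small \<gamma>(1-5)])
    qed
    then have "1 - card (\<M> n) * (7 * exp (- (\<gamma> * n / k n)))
        \<le> prob {w \<in> space (P n). mhat n (p n) w = mbar n}"
    proof (intro prob_argmin_ge[where R = ?R])
      show "finite (\<M> n)" using Pol(2) n1 by blast
      show "mbar n \<in> \<M> n" by (rule arg(1))
      show "mhat n (p n) \<in> measurable (P n) (count_space (\<M> n))"
        using mhat_measurable n1 p by auto
      show "?R m \<in> borel_measurable (P n)" if "m \<in> \<M> n" for m
        using model_sample.lpo_risk_measurable[OF sample[OF n1(1) that] n1(2) p] .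
      show "is_arg_min (\<lambda>m. ?R m w) (\<lambda>m. m \<in> \<M> n) (mhat n (p n) w)" if "w \<in> space (P n)" for w
        using mhat n1 p that by auto
    qed auto
    moreover have "card (\<M> n) * (7 * exp (- (\<gamma> * n / k n))) \<le> 7 / n"
    proof -
      have "card (\<M> n) * (7 * exp (- (\<gamma> * n / k n)))
          \<le> real n powr a\<^sub>M * (7 * exp (- ((a\<^sub>M + 1) * ln (real n))))"
        using Pol(2) n1 rate by (intro mult_mono) auto
      also have "\<dots> = 7 / n"
      proof -
        have "- ((a\<^sub>M + 1) * ln (real n)) = - (a\<^sub>M * ln (real n)) - ln (real n)"
          by (simp add: distrib_right)
        then have "exp (- ((a\<^sub>M + 1) * ln (real n))) = inverse (exp (a\<^sub>M * ln (real n))) / n"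
          using n1(3) by (simp only: exp_diff exp_minus exp_ln)
        then show ?thesis using n1(3) by (simp add: powr_def)
      qed
      finally show ?thesis .
    qed
    ultimately show ?case by linarith
  qed
  have upper: "\<forall>\<^sub>F n in sequentially. measure (P n) {w \<in> space (P n). mhat n (p n) w = mbar n} \<le> 1"
    using eventually_ge_at_top[of 1]
  proof eventually_elim
    case (elim n)
    interpret prob_space "P n" using prob elim by blast
    show ?case by (rule prob_le_1)
  qed
  have "(\<lambda>n. 1 - 7 / real n) \<longlonglongrightarrow> 1"
    using tendsto_diff[OF tendsto_const[of 1] lim_const_over_n[of "7::real"]] by simp
  then show ?thesis
    by (rule tendsto_sandwich[OF lower upper _ tendsto_const])
qed

end
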